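(* Let $n\ge2$ and let $W\colon\mathbb{R}\to[0,+\infty)$ be a potential satisfying (W1), (W2) and (W3), with $[a,b]$ the interval in (W2). There exists a family $\{u_\varepsilon\}\subset C^2(\mathbb{R}^n)$ of functions (indexed by the small parameter $\varepsilon>0$) such that $$\limsup_{\varepsilon\to0^+}\Big(E_\varepsilon(u_\varepsilon,\mathbb{R}^n)+G_\varepsilon(u_\varepsilon,\mathbb{R}^n)\Big)<+\infty$$ and $$\mu_\varepsilon\overset{*}{\rightharpoonup}\delta_0\quad\text{in duality with }C_0(\mathbb{R}^n)\text{ as }\varepsilon\to0^+,$$ where $$\mu_\varepsilon:=\frac{1}{\sigma_W^{a,b}}\left[\varepsilon|\nabla u_\varepsilon|^2+\frac{W(u_\varepsilon)}{\varepsilon}\right]\mathcal{L}^n,$$ $\delta_0$ denotes the Dirac mass centered at zero and $C_0(\mathbb{R}^n)$ is the space of continuous functions on $\mathbb{R}^n$ vanishing at infinity.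
   Context: Assumptions on $W$: (W1) $W\in C^2(\mathbb{R})$; (W2) there is an interval $[a,b]\subset\mathbb{R}$, $a<b$, such that $W(a)=W(b)=0$ and $W(u)>0$ for every $u\in(a,b)$; (W3) $W''(a)>0$ and $W''(b)>0$. $\sigma_W^{a,b}:=2\int_a^b\sqrt{W(u)}\,du$, and $\mathcal{L}^n$ is Lebesgue measure. For $\varepsilon>0$, $\Omega\subseteq\mathbb{R}^n$ open and sufficiently regular $u$, $$E_\varepsilon(u,\Omega):=\int_\Omega\left[\varepsilon|\nabla u|^2+\frac{W(u)}{\varepsilon}\right]dx,\qquad G_\varepsilon(u,\Omega):=\int_\Omega\left[2\varepsilon\Delta u-\frac{W'(u)}{\varepsilon}\right]^2\left[\varepsilon|\nabla u|^2+\frac{W(u)}{\varepsilon}\right]dx,$$ with values in $[0,+\infty]$. *)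

theory Defs
  imports "HOL-Probability.Probability"
begin

definition C2 :: "('a::real_normed_vector \<Rightarrow> 'b::real_normed_vector) \<Rightarrow> bool" where
  "C2 f \<longleftrightarrow> (\<exists>(D :: 'a \<Rightarrow> 'a \<Rightarrow>\<^sub>L 'b) (D2 :: 'a \<Rightarrow> 'a \<Rightarrow>\<^sub>L ('a \<Rightarrow>\<^sub>L 'b)).
     (\<forall>x. (f has_derivative blinfun_apply (D x)) (at x)) \<and>
     (\<forall>x. (D has_derivative blinfun_apply (D2 x)) (at x)) \<and>
     continuous_on UNIV D2)"

definition dir_deriv :: "'a::real_normed_vector \<Rightarrow> ('a \<Rightarrow> real) \<Rightarrow> 'a \<Rightarrow> real" where
  "dir_deriv v u x = deriv (\<lambda>t. u (x + t *\<^sub>R v)) 0"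

definition grad :: "('a::euclidean_space \<Rightarrow> real) \<Rightarrow> 'a \<Rightarrow> 'a" where
  "grad u x = (\<Sum>b\<in>Basis. dir_deriv b u x *\<^sub>R b)"

definition laplacian :: "('a::euclidean_space \<Rightarrow> real) \<Rightarrow> 'a \<Rightarrow> real" where
  "laplacian u x = (\<Sum>b\<in>Basis. dir_deriv b (dir_deriv b u) x)"

definition energy_density ::
  "(real \<Rightarrow> real) \<Rightarrow> real \<Rightarrow> ('a::euclidean_space \<Rightarrow> real) \<Rightarrow> 'a \<Rightarrow> real" where
  "energy_density W \<epsilon> u x = \<epsilon> * (norm (grad u x))\<^sup>2 + W (u x) / \<epsilon>"

text \<open>Both functionals take values in $[0,+\infty]$. For \<open>\<epsilon> > 0\<close> and \<open>W \<ge> 0\<close> the integrands are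
  nonnegative, so \<open>ennreal\<close> does not truncate them.\<close>

definition E_fun ::
  "(real \<Rightarrow> real) \<Rightarrow> real \<Rightarrow> ('a::euclidean_space \<Rightarrow> real) \<Rightarrow> 'a set \<Rightarrow> ennreal" where
  "E_fun W \<epsilon> u \<Omega> = (\<integral>\<^sup>+x\<in>\<Omega>. ennreal (energy_density W \<epsilon> u x) \<partial>lborel)"

definition G_fun ::
  "(real \<Rightarrow> real) \<Rightarrow> real \<Rightarrow> ('a::euclidean_space \<Rightarrow> real) \<Rightarrow> 'a set \<Rightarrow> ennreal" where
  "G_fun W \<epsilon> u \<Omega> =
     (\<integral>\<^sup>+x\<in>\<Omega>. ennreal ((2 * \<epsilon> * laplacian u x - deriv W (u x) / \<epsilon>)\<^sup>2 * energy_density W \<epsilon> u x)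
       \<partial>lborel)"

definition sigma_W :: "(real \<Rightarrow> real) \<Rightarrow> real \<Rightarrow> real \<Rightarrow> real" where
  "sigma_W W a b = 2 * integral {a..b} (\<lambda>s. sqrt (W s))"

definition energy_measure ::
  "(real \<Rightarrow> real) \<Rightarrow> real \<Rightarrow> real \<Rightarrow> real \<Rightarrow> ('a::euclidean_space \<Rightarrow> real) \<Rightarrow> 'a measure" where
  "energy_measure W a b \<epsilon> u =
     density lborel (\<lambda>x. ennreal (1 / sigma_W W a b * energy_density W \<epsilon> u x))"

definition C0_functions :: "('a::euclidean_space \<Rightarrow> real) set" where
  "C0_functions = {\<phi>. continuous_on UNIV \<phi> \<and> (\<phi> \<longlongrightarrow> 0) at_infinity}"

text \<open>The duality with $C_0$ only makes sense for finite Borel measures, and the Bochner integral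
  of a non-integrable function is 0 by convention. Finiteness is therefore part of the
  definition, eventually along the filter.\<close>

definition weak_star_conv ::
  "('i \<Rightarrow> 'a::euclidean_space measure) \<Rightarrow> 'a measure \<Rightarrow> 'i filter \<Rightarrow> bool" where
  "weak_star_conv \<mu> \<nu> F \<longleftrightarrow>
     (\<forall>\<^sub>F i in F. finite_measure (\<mu> i) \<and> sets (\<mu> i) = sets borel) \<and>
     finite_measure \<nu> \<and> sets \<nu> = sets borel \<and>
     (\<forall>\<phi>\<in>C0_functions. ((\<lambda>i. \<integral>x. \<phi> x \<partial>\<mu> i) \<longlongrightarrow> (\<integral>x. \<phi> x \<partial>\<nu>)) F)"

end

theory Submission
  imports Defs
begin

text \<open>
  The functional \<open>G\<close> weights the squared residual by the energy density, not by \<open>1 / \<epsilon>\<close>. The standard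
  transition layer across a sphere of radius \<open>r\<close> has residual \<open>2 \<kappa> V'\<close> with \<open>\<kappa> = (n - 1) / r\<close>, so its
  cost is of Willmore type and blows up as \<open>r\<close> shrinks at fixed total area. This cost can be removed.
  In the stretched variable, let the profile \<open>V\<close> satisfy the first order equation
  \<open>V'\<^sup>2 = W(V) + \<epsilon> h(V)\<close>. Then \<open>2 V'' = W'(V) + \<epsilon> h'(V)\<close>, and the residual across a sphere of
  curvature \<open>\<kappa>\<close> is \<open>h'(V) + 2 \<kappa> V'\<close>. As \<open>\<epsilon>\<close> tends to 0 the energy of the layer tends to
  \<open>2 \<integral> \<surd>W\<close> per unit area, and its contribution to \<open>G\<close> to
  \<open>\<integral> (h' + 2 \<kappa> \<surd>W)\<^sup>2 2 \<surd>W du\<close> over \<open>[a, b]\<close>. The choice \<open>h' = - 2 \<kappa> \<surd>W\<close> would make this vanish,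
  but \<open>h\<close> has to vanish at both wells. Since the wells are nondegenerate, \<open>\<surd>W\<close> vanishes linearly at
  them and \<open>\<integral> 1 / \<surd>W\<close> diverges, so the end conditions can be met by adding to \<open>h'\<close> a term
  that is comparable to a small multiple of \<open>1 / \<surd>W\<close> except very near the wells; the cost is then as small as desired (lemma
  \<open>curvature_corrector\<close>). A further fixed summand \<open>((u - a) (b - u))\<^bsup>3/2\<^esup>\<close> of \<open>h\<close> makes the profile
  reach both wells in finite time, hence glue in a \<open>C\<^sup>2\<close> way to constants, at a cost in \<open>G\<close> that does
  not depend on \<open>\<kappa>\<close> (lemmas \<open>finite_time_heteroclinic\<close> and \<open>transition_exists\<close>).
  
  A bound on \<open>G\<close> that is uniform in the curvature allows the following construction. For large \<open>M\<close>
  choose \<open>r\<close> such that \<open>2 M\<close> spheres of radius \<open>r\<close> have total area 1; as \<open>n \<ge> 2\<close>, \<open>r\<close> tends to 0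
  as \<open>M\<close> grows. For \<open>\<epsilon>\<close> small, \<open>M\<close> consecutive pairs of a transition from \<open>a\<close> to \<open>b\<close> and one from
  \<open>b\<close> back to \<open>a\<close> fit in a shell of thickness \<open>O(\<surd>\<epsilon>)\<close> around the sphere of radius \<open>r\<close>. The resulting
  radial function equals \<open>a\<close> outside this shell, has energy close to \<open>sigma_W W a b\<close>, and has \<open>G\<close> bounded
  by a constant that does not depend on \<open>M\<close> (lemmas \<open>radial_layer\<close> and \<open>eventually_concentrated\<close>). Letting
  \<open>M\<close> tend to infinity slowly as \<open>\<epsilon>\<close> tends to 0 (lemma \<open>diagonal_family\<close>) concentrates all the energy
  at the origin.
\<close>

section \<open>Autonomous first order equations on the line\<close>

lemma DERIV_everywhere_if_except_finite:
  fixes f f' :: "real \<Rightarrow> real"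
  assumes S: "finite S" and contf: "continuous_on UNIV f" and contf': "continuous_on UNIV f'"
    and der: "\<And>x. x \<notin> S \<Longrightarrow> (f has_real_derivative f' x) (at x)"
  shows "(f has_real_derivative f' x) (at x)"
proof -
  let ?I = "{x - 1..x + 1}"
  have c: "continuous_on ?I f'"
    using contf' continuous_on_subset by blast
  have int: "((\<lambda>y. f (x - 1) + integral {x - 1..y} f') has_real_derivative f' x) (at x within ?I)"
    by (rule derivative_eq_intros integral_has_real_derivative[OF c] | simp)+
  have eq: "f y = f (x - 1) + integral {x - 1..y} f'" if "y \<in> ?I" for y
  proof -
    have "(f' has_integral (f y - f (x - 1))) {x - 1..y}"
      using that S contf der
      by (intro fundamental_theorem_of_calculus_interior_strong[where S = S])
        (auto simp: has_real_derivative_iff_has_vector_derivative intro: continuous_on_subset)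
    then show ?thesis by (simp add: integral_unique)
  qed
  have "(f has_real_derivative f' x) (at x within ?I)"
    by (rule has_field_derivative_transform_within[OF int zero_less_one])
      (simp, rule eq[symmetric])
  moreover have "at x within ?I = at x"
    by (rule at_within_interior) (simp add: interior_atLeastAtMost_real)
  ultimately show ?thesis by simp
qed

text \<open>
  The equation \<open>q' = sqrt (g q)\<close> is solved by inverting the travel time
  \<open>\<Phi> u = \<integral> 1 / sqrt g\<close> over \<open>[a, u]\<close>, which is finite even at \<open>b\<close>. The solution is extended by the
  constants \<open>a\<close> and \<open>b\<close>; the extension is twice continuously differentiable because \<open>g\<close> and \<open>g'\<close>
  vanish at both ends.
\<close>

lemma finite_time_heteroclinic:
  fixes g g' :: "real \<Rightarrow> real" and a b :: real
  assumes ab: "a < b"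
    and contg: "continuous_on {a..b} g" and contg': "continuous_on {a..b} g'"
    and pos: "\<forall>u\<in>{a<..<b}. g u > 0"
    and der: "\<forall>u\<in>{a<..<b}. (g has_real_derivative g' u) (at u)"
    and ends: "g a = 0" "g b = 0" "g' a = 0" "g' b = 0"
    and int: "(\<lambda>u. 1 / sqrt (g u)) integrable_on {a..b}"
  defines "T \<equiv> integral {a..b} (\<lambda>u. 1 / sqrt (g u))"
  shows "0 < T \<and> (\<exists>q. (\<forall>t. q t \<in> {a..b}) \<and> (\<forall>t\<le>0. q t = a) \<and> (\<forall>t\<ge>T. q t = b) \<and>
    (\<forall>t. (q has_real_derivative sqrt (g (q t))) (at t)) \<and>
    (\<forall>t. ((\<lambda>t. sqrt (g (q t))) has_real_derivative g' (q t) / 2) (at t)))"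
proof -
  have g_pos: "g u > 0" and g_der: "(g has_real_derivative g' u) (at u)" if "u \<in> {a<..<b}" for u
    using pos der that by auto
  define \<Phi> where "\<Phi> u = integral {a..u} (\<lambda>u. 1 / sqrt (g u))" for u
  have \<Phi>a: "\<Phi> a = 0" and \<Phi>b: "\<Phi> b = T" by (simp_all add: \<Phi>_def T_def)
  have cont\<Phi>: "continuous_on {a..b} \<Phi>"
    unfolding \<Phi>_def by (rule indefinite_integral_continuous_1[OF int])
  have der\<Phi>: "(\<Phi> has_real_derivative 1 / sqrt (g u)) (at u)" if u: "u \<in> {a<..<b}" for u
  proof -
    have "isCont g u" using g_der[OF u] DERIV_isCont by blast
    then have "isCont (\<lambda>u. 1 / sqrt (g u)) u"
      using g_pos[OF u] by (intro continuous_intros) auto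
    then have "(\<Phi> has_vector_derivative 1 / sqrt (g u)) (at u within {a..b} - {})"
      unfolding \<Phi>_def using u int
      by (intro integral_has_vector_derivative_continuous_at)
        (auto simp: continuous_at_imp_continuous_at_within)
    moreover have "at u within {a..b} = at u"
      using u by (intro at_within_interior) (simp add: interior_atLeastAtMost_real)
    ultimately show ?thesis by (simp add: has_real_derivative_iff_has_vector_derivative)
  qed
  have mono: "\<Phi> x < \<Phi> y" if "a \<le> x" "x < y" "y \<le> b" for x y
  proof (rule DERIV_pos_imp_increasing_open[OF that(2)])
    show "\<exists>d. (\<Phi> has_real_derivative d) (at z) \<and> 0 < d" if "x < z" "z < y" for z
      using der\<Phi>[of z] g_pos[of z] that \<open>a \<le> x\<close> \<open>y \<le> b\<close>
      by (intro exI[of _ "1 / sqrt (g z)"]) auto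
    show "continuous_on {x..y} \<Phi>"
      using cont\<Phi> that by (auto intro: continuous_on_subset)
  qed
  have T: "0 < T" using mono[of a b] ab \<Phi>a \<Phi>b by simp
  have inj: "inj_on \<Phi> {a..b}"
    by (rule linorder_inj_onI) (use mono in \<open>force+\<close>)
  have img: "\<Phi> ` {a..b} = {0..T}"
  proof
    show "\<Phi> ` {a..b} \<subseteq> {0..T}"
      using mono \<Phi>a \<Phi>b by (fastforce simp: le_less)
    show "{0..T} \<subseteq> \<Phi> ` {a..b}"
    proof
      fix y assume "y \<in> {0..T}"
      then obtain x where "a \<le> x" "x \<le> b" "\<Phi> x = y"
        using IVT'[of \<Phi> a y b] ab cont\<Phi> \<Phi>a \<Phi>b by auto
      then show "y \<in> \<Phi> ` {a..b}" by auto
    qed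
  qed
  \<comment> \<open>The inverse of the travel time on \<open>[0, T]\<close>, extended by clamping the time.\<close>
  define q0 where "q0 = the_inv_into {a..b} \<Phi>"
  have q0\<Phi>: "q0 (\<Phi> x) = x" if "x \<in> {a..b}" for x
    unfolding q0_def by (rule the_inv_into_f_f[OF inj that])
  have \<Phi>q0: "\<Phi> (q0 y) = y" and q0mem: "q0 y \<in> {a..b}" if "y \<in> {0..T}" for y
    using that q0\<Phi> unfolding img[symmetric] by auto
  have q0a: "q0 0 = a" and q0b: "q0 T = b"
    using q0\<Phi>[of a] q0\<Phi>[of b] ab \<Phi>a \<Phi>b by auto
  have contq0: "continuous_on {0..T} q0"
    using continuous_on_inv[OF cont\<Phi>, of q0] q0\<Phi> img by auto
  define q where "q t = q0 (max 0 (min T t))" for t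
  have clamp: "max 0 (min T t) \<in> {0..T}" for t using T by auto
  have qmem: "q t \<in> {a..b}" for t unfolding q_def by (rule q0mem[OF clamp])
  have contq: "continuous_on UNIV q"
    unfolding q_def
    by (rule continuous_on_compose2[OF contq0]) (use clamp in \<open>auto intro!: continuous_intros\<close>)
  have qle: "q t = a" if "t \<le> 0" for t using that T q0a by (simp add: q_def max_def min_def)
  have qge: "q t = b" if "t \<ge> T" for t using that T q0b by (simp add: q_def max_def min_def)
  have qin: "\<Phi> (q t) = t" "q t \<in> {a<..<b}" if "t \<in> {0<..<T}" for t
  proof -
    have *: "q t = q0 t" using that by (simp add: q_def max_def min_def)
    show 1: "\<Phi> (q t) = t" using \<Phi>q0[of t] that * by simp
    show "q t \<in> {a<..<b}"
      using qmem[of t] 1 \<Phi>a \<Phi>b that by (cases "q t = a"; cases "q t = b") auto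
  qed
  have derq_in: "(q has_real_derivative sqrt (g (q t))) (at t)" if t: "t \<in> {0<..<T}" for t
  proof -
    have "(q has_real_derivative inverse (1 / sqrt (g (q t)))) (at t)"
    proof (rule DERIV_inverse_function[where f = \<Phi> and a = 0 and b = T])
      show "(\<Phi> has_real_derivative 1 / sqrt (g (q t))) (at (q t))"
        by (rule der\<Phi>[OF qin(2)[OF t]])
      show "1 / sqrt (g (q t)) \<noteq> 0" using g_pos[OF qin(2)[OF t]] by simp
      show "isCont q t" using contq by (simp add: continuous_on_eq_continuous_at)
    qed (use t qin in auto)
    then show ?thesis by simp
  qed
  have outside: "(f has_real_derivative 0) (at t)"
    if "t < 0 \<or> t > T" and "\<And>s. s \<le> 0 \<Longrightarrow> f s = c" "\<And>s. s \<ge> T \<Longrightarrow> f s = d"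
    for f :: "real \<Rightarrow> real" and t c d
  proof (cases "t < 0")
    case True
    have "((\<lambda>_. c) has_real_derivative 0) (at t)" by simp
    then show ?thesis
      by (rule has_field_derivative_transform_within_open[where S = "{..<0}"])
        (use True that in auto)
  next
    case False
    have "((\<lambda>_. d) has_real_derivative 0) (at t)" by simp
    then show ?thesis
      by (rule has_field_derivative_transform_within_open[where S = "{T<..}"])
        (use False that in auto)
  qed
  have contsq: "continuous_on UNIV (\<lambda>t. sqrt (g (q t)))"
    by (intro continuous_intros continuous_on_compose2[OF contg contq]) (use qmem in auto)
  have contg'q: "continuous_on UNIV (\<lambda>t. g' (q t) / 2)"
    by (intro continuous_intros continuous_on_compose2[OF contg' contq]) (use qmem in auto)
  \<comment> \<open>Continuity of the right-hand sides takes care of the two gluing times.\<close>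
  have der1: "(q has_real_derivative sqrt (g (q t))) (at t)" for t
  proof (rule DERIV_everywhere_if_except_finite[of "{0, T}"])
    fix t assume "t \<notin> {0, T}"
    then consider "t \<in> {0<..<T}" | "t < 0 \<or> t > T" by force
    then show "(q has_real_derivative sqrt (g (q t))) (at t)"
      using derq_in outside[of t q a b] qle qge ends by cases auto
  qed (use contq contsq in auto)
  have der2: "((\<lambda>t. sqrt (g (q t))) has_real_derivative g' (q t) / 2) (at t)" for t
  proof (rule DERIV_everywhere_if_except_finite[of "{0, T}"])
    fix t assume "t \<notin> {0, T}"
    then consider "t \<in> {0<..<T}" | "t < 0 \<or> t > T" by force
    then show "((\<lambda>t. sqrt (g (q t))) has_real_derivative g' (q t) / 2) (at t)"
    proof cases
      case 1
      note u = qin(2)[OF 1]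
      have "((\<lambda>t. g (q t)) has_real_derivative g' (q t) * sqrt (g (q t))) (at t)"
        by (rule DERIV_chain2[OF g_der[OF u] derq_in[OF 1]])
      from DERIV_chain2[OF DERIV_real_sqrt[OF g_pos[OF u]] this]
      show ?thesis using g_pos[OF u] by (simp add: field_simps)
    next
      case 2
      then show ?thesis
        using outside[of t "\<lambda>t. sqrt (g (q t))" 0 0] qle qge ends by auto
    qed
  qed (use contsq contg'q in auto)
  show ?thesis using T qmem qle qge der1 der2 by blast
qed

section \<open>Double-well potentials near their wells\<close>

lemma C2_real_derivs:
  fixes W :: "real \<Rightarrow> real"
  assumes "C2 W"
  shows "(W has_real_derivative deriv W s) (at s)"
    and "(deriv W has_real_derivative deriv (deriv W) s) (at s)"
    and "continuous_on UNIV (deriv (deriv W))"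
proof -
  obtain D D2 where *: "(\<forall>x. (W has_derivative blinfun_apply (D x)) (at x)) \<and>
     (\<forall>x. (D has_derivative blinfun_apply (D2 x)) (at x)) \<and> continuous_on UNIV D2"
    using assms unfolding C2_def by (elim exE)
  then have D: "(W has_derivative blinfun_apply (D x)) (at x)"
    and D2: "(D has_derivative blinfun_apply (D2 x)) (at x)"
    and cont: "continuous_on UNIV D2" for x by auto
  have 1: "(W has_real_derivative D x 1) (at x)" for x
  proof -
    have "blinfun_apply (D x) = (*) (D x 1)"
    proof
      fix y show "D x y = D x 1 * y" using blinfun.scaleR_right[of "D x" y 1] by simp
    qed
    then show ?thesis using D[of x] by (simp add: has_field_derivative_def)
  qed
  then have W': "deriv W = (\<lambda>x. D x 1)" by (auto intro!: DERIV_imp_deriv)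
  have 2: "(deriv W has_real_derivative D2 x 1 1) (at x)" for x
  proof -
    have "((\<lambda>x. D x 1) has_derivative (\<lambda>y. D2 x y 1)) (at x)"
      by (auto intro!: derivative_eq_intros D2)
    moreover have "(\<lambda>y. D2 x y 1) = (*) (D2 x 1 1)"
    proof
      fix y show "D2 x y 1 = D2 x 1 1 * y"
        using blinfun.scaleR_right[of "D2 x" y 1] by (simp add: blinfun.scaleR_left)
    qed
    ultimately show ?thesis unfolding W' by (simp add: has_field_derivative_def)
  qed
  then have W'': "deriv (deriv W) = (\<lambda>x. D2 x 1 1)" by (auto intro!: DERIV_imp_deriv)
  show "(W has_real_derivative deriv W s) (at s)" using 1 W' by simp
  show "(deriv W has_real_derivative deriv (deriv W) s) (at s)" using 2 W'' by simp
  show "continuous_on UNIV (deriv (deriv W))"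
    unfolding W'' by (intro continuous_intros cont)
qed

lemma deriv_zero_at_minimum:
  fixes W :: "real \<Rightarrow> real"
  assumes "C2 W" "\<And>s. W s \<ge> 0" "W z = 0"
  shows "deriv W z = 0"
  using DERIV_local_min[OF C2_real_derivs(1)[OF assms(1)], of 1 z] assms by simp

text \<open>
  Second order Taylor expansion at a zero of a nonnegative function, with the intermediate point
  possibly equal to an endpoint.
\<close>

lemma Taylor_at_minimum:
  fixes W :: "real \<Rightarrow> real"
  assumes "C2 W" "\<And>s. W s \<ge> 0" "W z = 0"
  obtains t where "min u z \<le> t" "t \<le> max u z" "W u = deriv (deriv W) t / 2 * (u - z)\<^sup>2"
proof (cases "u = z")
  case True
  show ?thesis
    by (rule that[of z]) (use True assms(3) in \<open>auto\<close>)
next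
  case False
  define D where "D m = (if m = 0 then W else if m = 1 then deriv W else deriv (deriv W))" for m :: nat
  have "\<exists>t. (if u < z then u < t \<and> t < z else z < t \<and> t < u) \<and>
      W u = (\<Sum>m<2. D m z / fact m * (u - z) ^ m) + D 2 t / fact 2 * (u - z) ^ 2"
  proof (rule Taylor[where a = "min u z" and b = "max u z"])
    have "(D m has_real_derivative D (Suc m) t) (at t)" if "m < 2" for m t
    proof -
      consider "m = 0" | "m = 1" using \<open>m < 2\<close> by linarith
      then show ?thesis using C2_real_derivs(1,2)[OF assms(1), of t] by cases (simp_all add: D_def)
    qed
    then show "\<forall>m t. m < 2 \<and> min u z \<le> t \<and> t \<le> max u z \<longrightarrow>
        (D m has_real_derivative D (Suc m) t) (at t)" by blast
  qed (use False in \<open>auto simp: D_def\<close>)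
  moreover have "(\<Sum>m<2. D m z / fact m * (u - z) ^ m) = W z + deriv W z * (u - z)"
    by (simp add: D_def numeral_2_eq_2)
  ultimately obtain t where t: "if u < z then u < t \<and> t < z else z < t \<and> t < u"
    and W: "W u = W z + deriv W z * (u - z) + deriv (deriv W) t / 2 * (u - z)\<^sup>2"
    by (auto simp: D_def)
  show ?thesis
    using t W deriv_zero_at_minimum[OF assms] assms(3) by (intro that[of t]) (auto split: if_splits)
qed

lemma quadratic_growth_at_minimum:
  fixes W :: "real \<Rightarrow> real"
  assumes W: "C2 W" "\<And>s. W s \<ge> 0" "W z = 0" and pos: "deriv (deriv W) z > 0"
  shows "\<exists>c>0. \<exists>\<delta>>0. \<forall>u. \<bar>u - z\<bar> < \<delta> \<longrightarrow> c * (u - z)\<^sup>2 \<le> W u"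
proof -
  have "isCont (deriv (deriv W)) z"
    using C2_real_derivs(3)[OF W(1)] by (simp add: continuous_on_eq_continuous_at)
  then obtain \<delta> where \<delta>: "\<delta> > 0"
    "\<And>s. \<bar>s - z\<bar> < \<delta> \<Longrightarrow> \<bar>deriv (deriv W) s - deriv (deriv W) z\<bar> < deriv (deriv W) z / 2"
    using pos unfolding continuous_at_eps_delta dist_real_def by (metis half_gt_zero)
  have "deriv (deriv W) z / 4 * (u - z)\<^sup>2 \<le> W u" if u: "\<bar>u - z\<bar> < \<delta>" for u
  proof -
    obtain t where t: "min u z \<le> t" "t \<le> max u z" "W u = deriv (deriv W) t / 2 * (u - z)\<^sup>2"
      using Taylor_at_minimum[OF W] by blast
    have "\<bar>t - z\<bar> < \<delta>" using t(1,2) u by linarith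
    then have "deriv (deriv W) z / 4 \<le> deriv (deriv W) t / 2"
      using \<delta>(2)[of t] by linarith
    then show ?thesis unfolding t(3) by (rule mult_right_mono) simp
  qed
  moreover have "deriv (deriv W) z / 4 > 0" using pos by simp
  ultimately show ?thesis using \<delta>(1) by blast
qed

text \<open>
  The product of the distances of \<open>u\<close> to the two wells. It is a smooth substitute for the
  distance to \<open>{a, b}\<close> and is comparable to it on \<open>[a, b]\<close>.
\<close>

definition end_dist :: "real \<Rightarrow> real \<Rightarrow> real \<Rightarrow> real" where
  "end_dist a b u = (u - a) * (b - u)"

lemma end_dist_nonneg: "u \<in> {a..b} \<Longrightarrow> 0 \<le> end_dist a b u"
  by (simp add: end_dist_def)

lemma end_dist_pos: "u \<in> {a<..<b} \<Longrightarrow> 0 < end_dist a b u"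
  by (simp add: end_dist_def)

lemma end_dist_ends [simp]: "end_dist a b a = 0" "end_dist a b b = 0"
  by (simp_all add: end_dist_def)

lemma continuous_on_end_dist [continuous_intros]:
  "continuous_on S f \<Longrightarrow> continuous_on S (\<lambda>x. end_dist a b (f x))"
  unfolding end_dist_def by (intro continuous_intros)

lemma DERIV_end_dist: "(end_dist a b has_real_derivative a + b - 2 * u) (at u)"
  unfolding end_dist_def by (auto intro!: derivative_eq_intros)

lemma end_dist_le:
  assumes "u \<in> {a..b}"
  shows "end_dist a b u \<le> (b - a) * (u - a)" "end_dist a b u \<le> (b - a) * (b - u)"
    "end_dist a b u \<le> (b - a)\<^sup>2"
proof -
  show "end_dist a b u \<le> (b - a) * (u - a)"
    unfolding end_dist_def mult.commute[of "u - a"] by (intro mult_right_mono) (use assms in auto)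
  show "end_dist a b u \<le> (b - a) * (b - u)"
    unfolding end_dist_def by (intro mult_right_mono) (use assms in auto)
  show "end_dist a b u \<le> (b - a)\<^sup>2"
    unfolding end_dist_def power2_eq_square by (intro mult_mono) (use assms in auto)
qed

lemma end_dist_ge:
  assumes "u \<in> {a..b}"
  shows "u \<le> (a + b) / 2 \<Longrightarrow> (b - a) / 2 * (u - a) \<le> end_dist a b u"
    and "u \<ge> (a + b) / 2 \<Longrightarrow> (b - a) / 2 * (b - u) \<le> end_dist a b u"
proof -
  show "(b - a) / 2 * (u - a) \<le> end_dist a b u" if "u \<le> (a + b) / 2"
    unfolding end_dist_def mult.commute[of "u - a"]
    using assms that by (intro mult_right_mono) (auto simp: field_simps)
  show "(b - a) / 2 * (b - u) \<le> end_dist a b u" if "u \<ge> (a + b) / 2"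
    unfolding end_dist_def
    using assms that by (intro mult_right_mono) (auto simp: field_simps)
qed

text \<open>
  A quadratic bound at each well, required only on the half of the interval next to it, gives a bound
  by the square of \<open>end_dist\<close> on all of \<open>[a, b]\<close>.
\<close>

lemma le_end_dist_squareI:
  assumes u: "u \<in> {a..b}" and ab: "a < b" and C: "C \<ge> 0"
    and left: "u \<le> (a + b) / 2 \<Longrightarrow> y \<le> C * (u - a)\<^sup>2"
    and right: "u \<ge> (a + b) / 2 \<Longrightarrow> y \<le> C * (b - u)\<^sup>2"
  shows "y \<le> 4 * C / (b - a)\<^sup>2 * (end_dist a b u)\<^sup>2"
proof -
  have *: "C * v\<^sup>2 \<le> 4 * C / (b - a)\<^sup>2 * (end_dist a b u)\<^sup>2"
    if "0 \<le> v" "(b - a) / 2 * v \<le> end_dist a b u" for v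
  proof -
    have "((b - a) / 2 * v)\<^sup>2 \<le> (end_dist a b u)\<^sup>2"
      using that ab by (intro power_mono) auto
    then have *: "4 * C / (b - a)\<^sup>2 * ((b - a) / 2 * v)\<^sup>2 \<le> 4 * C / (b - a)\<^sup>2 * (end_dist a b u)\<^sup>2"
      using C by (intro mult_left_mono) auto
    have "((b - a) / 2 * v)\<^sup>2 = (b - a)\<^sup>2 * v\<^sup>2 / 4"
      by (simp add: power_mult_distrib power_divide)
    then have "4 * C / (b - a)\<^sup>2 * ((b - a) / 2 * v)\<^sup>2 = C * v\<^sup>2"
      using ab by (simp only:) (simp add: field_simps)
    with * show ?thesis by (simp only:)
  qed
  consider "u \<le> (a + b) / 2" "y \<le> C * (u - a)\<^sup>2" | "u \<ge> (a + b) / 2" "y \<le> C * (b - u)\<^sup>2"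
    using left right by linarith
  then show ?thesis
    using *[of "u - a"] *[of "b - u"] end_dist_ge[OF u] u by cases auto
qed

text \<open>
  Nondegeneracy of the wells enters the whole argument only through these two bounds.
\<close>

lemma sqrt_double_well_comparable:
  fixes W :: "real \<Rightarrow> real"
  assumes W: "C2 W" "\<And>s. W s \<ge> 0"
    and wells: "a < b" "W a = 0" "W b = 0" "\<And>s. s \<in> {a<..<b} \<Longrightarrow> W s > 0"
    and nondeg: "deriv (deriv W) a > 0" "deriv (deriv W) b > 0"
  obtains c1 c2 where "c1 > 0" "c2 > 0"
    "\<And>u. u \<in> {a..b} \<Longrightarrow> c1 * end_dist a b u \<le> sqrt (W u)"
    "\<And>u. u \<in> {a..b} \<Longrightarrow> sqrt (W u) \<le> c2 * end_dist a b u"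
proof -
  let ?d = "end_dist a b"
  define L where "L = b - a"
  have L: "L > 0" using wells by (simp add: L_def)
  have contW: "continuous_on S W" for S
    using C2_real_derivs(1)[OF W(1)] DERIV_isCont by (blast intro: continuous_at_imp_continuous_on)
  have "continuous_on {a..b} (deriv (deriv W))"
    using C2_real_derivs(3)[OF W(1)] continuous_on_subset by blast
  then have "bounded (deriv (deriv W) ` {a..b})"
    by (intro compact_imp_bounded compact_continuous_image) auto
  then obtain M0 where M0: "\<And>u. u \<in> {a..b} \<Longrightarrow> \<bar>deriv (deriv W) u\<bar> \<le> M0"
    unfolding bounded_iff real_norm_def by blast
  define M where "M = max 1 M0"
  have M: "M > 0" "\<And>u. u \<in> {a..b} \<Longrightarrow> deriv (deriv W) u \<le> M"
    using M0 by (force simp: M_def)+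
  have up: "W u \<le> M / 2 * (u - z)\<^sup>2" if z: "z \<in> {a..b}" "W z = 0" and u: "u \<in> {a..b}" for u z
  proof -
    obtain t where t: "min u z \<le> t" "t \<le> max u z" "W u = deriv (deriv W) t / 2 * (u - z)\<^sup>2"
      using Taylor_at_minimum[OF W z(2)] by blast
    then have "deriv (deriv W) t \<le> M" using z u by (intro M) auto
    then show ?thesis unfolding t(3) by (intro mult_right_mono) auto
  qed
  have upper: "sqrt (W u) \<le> sqrt (4 * (M / 2) / (b - a)\<^sup>2) * ?d u" if u: "u \<in> {a..b}" for u
  proof -
    have "W u \<le> 4 * (M / 2) / (b - a)\<^sup>2 * (?d u)\<^sup>2"
      using up[of a u] up[of b u] u wells M
      by (intro le_end_dist_squareI) (auto simp: power2_commute[of u b])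
    then have "sqrt (W u) \<le> sqrt (4 * (M / 2) / (b - a)\<^sup>2 * (?d u)\<^sup>2)" by simp
    then show ?thesis
      by (simp only: real_sqrt_mult real_sqrt_abs abs_of_nonneg[OF end_dist_nonneg[OF u]])
  qed
  obtain ca \<delta>a where ca: "ca > 0" "\<delta>a > 0" "\<And>u. \<bar>u - a\<bar> < \<delta>a \<Longrightarrow> ca * (u - a)\<^sup>2 \<le> W u"
    using quadratic_growth_at_minimum[OF W wells(2) nondeg(1)] by blast
  obtain cb \<delta>b where cb: "cb > 0" "\<delta>b > 0" "\<And>u. \<bar>u - b\<bar> < \<delta>b \<Longrightarrow> cb * (u - b)\<^sup>2 \<le> W u"
    using quadratic_growth_at_minimum[OF W wells(3) nondeg(2)] by blast
  define \<delta> where "\<delta> = min (min \<delta>a \<delta>b) L / 2"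
  have \<delta>: "0 < \<delta>" "\<delta> < \<delta>a" "\<delta> < \<delta>b" "\<delta> \<le> L / 2" using ca(2) cb(2) L by (auto simp: \<delta>_def)
  have "{a + \<delta>..b - \<delta>} \<noteq> {}" using \<delta>(4) by (simp add: L_def)
  then obtain u0 where u0: "u0 \<in> {a + \<delta>..b - \<delta>}" "\<And>u. u \<in> {a + \<delta>..b - \<delta>} \<Longrightarrow> W u0 \<le> W u"
    using continuous_attains_inf[OF _ _ contW] by (metis compact_Icc)
  have W0: "W u0 > 0" using u0(1) \<delta>(1) by (intro wells) auto
  define c where "c = min (min (ca / L\<^sup>2) (cb / L\<^sup>2)) (W u0 / (L\<^sup>2)\<^sup>2)"
  have c: "c > 0" using ca cb W0 L by (auto simp: c_def)
  have lower: "sqrt c * ?d u \<le> sqrt (W u)" if u: "u \<in> {a..b}" for u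
  proof -
    note d = end_dist_nonneg[OF u] end_dist_le[OF u, folded L_def]
    have sq: "(?d u)\<^sup>2 \<le> L\<^sup>2 * (u - a)\<^sup>2" "(?d u)\<^sup>2 \<le> L\<^sup>2 * (u - b)\<^sup>2" "(?d u)\<^sup>2 \<le> (L\<^sup>2)\<^sup>2"
      using power_mono[OF d(2) d(1), of 2] power_mono[OF d(3) d(1), of 2] power_mono[OF d(4) d(1), of 2]
      by (simp_all add: power_mult_distrib power2_commute[of u b])
    have *: "c * (?d u)\<^sup>2 \<le> y" if "c \<le> k / m" "(?d u)\<^sup>2 \<le> m * v" "k * v \<le> y" "m > 0" "k > 0" for k m v y
    proof -
      have "c * (?d u)\<^sup>2 \<le> k / m * (m * v)"
        using that c by (intro mult_mono) auto
      then show ?thesis using that by simp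
    qed
    \<comment> \<open>Near each well the quadratic growth applies; in between \<open>W\<close> has a positive minimum.\<close>
    consider "\<bar>u - a\<bar> < \<delta>a" | "\<bar>u - b\<bar> < \<delta>b" | "u \<in> {a + \<delta>..b - \<delta>}"
      using \<delta> u by force
    then have "c * (?d u)\<^sup>2 \<le> W u"
    proof cases
      case 1
      show ?thesis by (rule *[OF _ sq(1) ca(3)[OF 1]]) (use ca L in \<open>auto simp: c_def\<close>)
    next
      case 2
      show ?thesis by (rule *[OF _ sq(2) cb(3)[OF 2]]) (use cb L in \<open>auto simp: c_def\<close>)
    next
      case 3
      show ?thesis
        by (rule *[of "W u0" "(L\<^sup>2)\<^sup>2" 1]) (use sq(3) u0(2)[OF 3] W0 L in \<open>auto simp: c_def\<close>)
    qed
    then have "sqrt (c * (?d u)\<^sup>2) \<le> sqrt (W u)" by simp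
    then show ?thesis using d(1) by (simp add: real_sqrt_mult)
  qed
  show ?thesis
    by (rule that[of "sqrt c" "sqrt (4 * (M / 2) / (b - a)\<^sup>2)"]) (use c M wells lower upper in auto)
qed

section \<open>The curvature corrector\<close>

text \<open>
  The infimum of \<open>\<integral> (h' + 2 \<kappa> w)\<^sup>2 2 w\<close> over functions \<open>h\<close> vanishing at \<open>a\<close> and \<open>b\<close> is 0. A
  minimiser would have \<open>(h' + 2 \<kappa> w) w\<close> constant, which suggests \<open>h' = c \<rho> - 2 \<kappa> w\<close> with
  \<open>\<rho> = d / (d\<^sup>2 + \<mu>)\<close>, where \<open>d = end_dist a b\<close>; this \<open>\<rho>\<close> is close to \<open>1 / d\<close> for small \<open>\<mu>\<close>, yet
  vanishes at the wells. The condition \<open>h b = 0\<close> forces \<open>c = 2 \<kappa> \<integral>w / \<integral>\<rho>\<close>, the cost is at most a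
  multiple of \<open>c\<^sup>2 \<integral>\<rho>\<close>, and \<open>\<integral>\<rho>\<close> grows logarithmically as \<open>\<mu>\<close> tends to 0.
\<close>

lemma curvature_corrector:
  fixes w :: "real \<Rightarrow> real"
  assumes ab: "a < b" and contw: "continuous_on {a..b} w" and c2: "c2 > 0"
    and w_bounds: "\<forall>u\<in>{a..b}. 0 \<le> w u \<and> w u \<le> c2 * end_dist a b u"
    and \<eta>: "\<eta> > 0"
  shows "\<exists>h h' K. continuous_on {a..b} h \<and> continuous_on {a..b} h' \<and>
    (\<forall>u\<in>{a<..<b}. (h has_real_derivative h' u) (at u)) \<and> 0 \<le> K \<and>
    (\<forall>u\<in>{a..b}. \<bar>h u\<bar> \<le> K * (end_dist a b u)\<^sup>2) \<and>
    (\<forall>u\<in>{a..b}. \<bar>h' u\<bar> \<le> K * end_dist a b u) \<and>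
    integral {a..b} (\<lambda>u. (h' u + 2 * \<kappa> * w u)\<^sup>2 * (2 * w u)) \<le> \<eta>"
proof -
  let ?d = "end_dist a b"
  have w: "0 \<le> w u" "w u \<le> c2 * ?d u" if "u \<in> {a..b}" for u
    using w_bounds that by auto
  define L where "L = b - a"
  have L: "L > 0" using ab by (simp add: L_def)
  define \<rho> where "\<rho> \<mu> u = ?d u / ((?d u)\<^sup>2 + \<mu>)" for \<mu> u
  have pos: "(?d u)\<^sup>2 + \<mu> > 0" if "\<mu> > 0" for \<mu> u
    using that by (simp add: add_nonneg_pos)
  have cont\<rho>: "continuous_on S (\<rho> \<mu>)" if "\<mu> > 0" for \<mu> S
    unfolding \<rho>_def using pos[OF that] by (intro continuous_intros) (auto simp: less_imp_neq[symmetric])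
  have \<rho>0: "0 \<le> \<rho> \<mu> u" if "\<mu> > 0" "u \<in> {a..b}" for \<mu> u
    unfolding \<rho>_def using pos[OF that(1), of u] end_dist_nonneg[OF that(2)] by simp
  \<comment> \<open>On the left half, \<open>\<rho> d'\<close> is the derivative of a logarithm and \<open>d' \<le> b - a\<close>.\<close>
  have int_big: "\<exists>\<mu>>0. R \<le> integral {a..b} (\<rho> \<mu>)" for R
  proof -
    define m where "m = (a + b) / 2"
    have dm: "?d m > 0" using ab by (simp add: end_dist_def m_def)
    define \<mu> where "\<mu> = exp (ln ((?d m)\<^sup>2) - 2 * L * R)"
    have \<mu>: "\<mu> > 0" by (simp add: \<mu>_def)
    \<comment> \<open>\<open>Q' = \<rho> d' / (b - a)\<close>\<close>
    define Q where "Q u = 1 / (2 * L) * ln ((?d u)\<^sup>2 + \<mu>)" for u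
    have Q: "((\<lambda>u. \<rho> \<mu> u * (a + b - 2 * u) / L) has_integral (Q m - Q a)) {a..m}"
    proof (rule fundamental_theorem_of_calculus)
      show "(Q has_vector_derivative \<rho> \<mu> u * (a + b - 2 * u) / L) (at u within {a..m})" for u
      proof -
        have "(Q has_real_derivative 1 / (2 * L) * (2 * ?d u * (a + b - 2 * u) / ((?d u)\<^sup>2 + \<mu>))) (at u)"
        proof -
          have "((\<lambda>u. ln ((?d u)\<^sup>2 + \<mu>)) has_real_derivative
              2 * ((a + b - 2 * u) * ?d u) / ((?d u)\<^sup>2 + \<mu>)) (at u)"
            using pos[OF \<mu>, of u] by (auto intro!: derivative_eq_intros DERIV_end_dist)
          from DERIV_cmult[OF this, of "1 / (2 * L)"] show ?thesis
            unfolding Q_def by (simp only: divide_inverse mult_ac)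
        qed
        moreover have "1 / (2 * L) * (2 * ?d u * (a + b - 2 * u) / ((?d u)\<^sup>2 + \<mu>)) =
            \<rho> \<mu> u * (a + b - 2 * u) / L"
          by (simp add: \<rho>_def)
        ultimately show ?thesis
          unfolding has_real_derivative_iff_has_vector_derivative
          by (metis has_vector_derivative_at_within)
      qed
    qed (use ab in \<open>simp add: m_def\<close>)
    have "ln \<mu> = ln ((?d m)\<^sup>2) - 2 * L * R" by (simp add: \<mu>_def)
    moreover have "ln ((?d m)\<^sup>2) \<le> ln ((?d m)\<^sup>2 + \<mu>)"
      using dm \<mu> by (subst ln_le_cancel_iff) (auto intro!: add_pos_pos)
    ultimately have "2 * L * R \<le> ln ((?d m)\<^sup>2 + \<mu>) - ln \<mu>" by linarith
    also have "\<dots> = 2 * L * (Q m - Q a)" using L by (simp add: Q_def field_simps)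
    finally have "R \<le> Q m - Q a" using L by simp
    also have "\<dots> = integral {a..m} (\<lambda>u. \<rho> \<mu> u * (a + b - 2 * u) / L)"
      by (rule integral_unique[OF Q, symmetric])
    also have "\<dots> \<le> integral {a..m} (\<rho> \<mu>)"
    proof (rule integral_le)
      fix u assume u: "u \<in> {a..m}"
      have "\<rho> \<mu> u * (a + b - 2 * u) \<le> \<rho> \<mu> u * L"
        using u ab by (intro mult_left_mono \<rho>0[OF \<mu>]) (auto simp: L_def m_def)
      then show "\<rho> \<mu> u * (a + b - 2 * u) / L \<le> \<rho> \<mu> u" using L by (simp add: field_simps)
    qed (rule has_integral_integrable[OF Q] integrable_continuous_interval cont\<rho>[OF \<mu>])+
    also have "\<dots> \<le> integral {a..b} (\<rho> \<mu>)"
      using \<rho>0[OF \<mu>] ab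
      by (intro integral_subset_le integrable_continuous_interval cont\<rho>[OF \<mu>]) (auto simp: m_def)
    finally show ?thesis using \<mu> by blast
  qed
  define S where "S = integral {a..b} w"
  obtain \<mu> where \<mu>: "\<mu> > 0" and big: "8 * c2 * \<kappa>\<^sup>2 * S\<^sup>2 / \<eta> + 1 \<le> integral {a..b} (\<rho> \<mu>)"
    using int_big by blast
  define I where "I = integral {a..b} (\<rho> \<mu>)"
  have "8 * c2 * \<kappa>\<^sup>2 * S\<^sup>2 / \<eta> \<ge> 0" using c2 \<eta> by simp
  then have I: "I > 0" "8 * c2 * \<kappa>\<^sup>2 * S\<^sup>2 / \<eta> \<le> I" using big by (auto simp: I_def)
  define c where "c = 2 * \<kappa> * S / I"
  define h' where "h' u = c * \<rho> \<mu> u - 2 * \<kappa> * w u" for u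
  define h where "h u = integral {a..u} h'" for u
  have conth': "continuous_on {a..b} h'"
    unfolding h'_def by (intro continuous_intros cont\<rho>[OF \<mu>] contw)
  have inth': "h' integrable_on {a..b}" using conth' by (rule integrable_continuous_interval)
  have "integral {a..b} h' = c * I - 2 * \<kappa> * S"
    unfolding h'_def I_def S_def
    by (subst integral_diff)
      (auto intro!: integrable_continuous_interval continuous_intros cont\<rho>[OF \<mu>] contw)
  also have "\<dots> = 0" using I by (simp add: c_def)
  finally have hb: "h b = 0" by (simp add: h_def)
  define K0 where "K0 = \<bar>c\<bar> / \<mu> + 2 * \<bar>\<kappa>\<bar> * c2"
  have K0: "K0 \<ge> 0" using \<mu> c2 by (simp add: K0_def)
  have h'_le: "\<bar>h' u\<bar> \<le> K0 * ?d u" if u: "u \<in> {a..b}" for u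
  proof -
    note d = end_dist_nonneg[OF u]
    have "\<rho> \<mu> u \<le> ?d u / \<mu>"
      unfolding \<rho>_def using \<mu> d by (intro divide_left_mono) (auto simp: pos)
    then have "\<bar>c * \<rho> \<mu> u\<bar> \<le> \<bar>c\<bar> * (?d u / \<mu>)"
      using \<rho>0[OF \<mu> u] by (simp only: abs_mult abs_of_nonneg) (rule mult_left_mono, auto)
    moreover have "\<bar>2 * \<kappa> * w u\<bar> \<le> 2 * \<bar>\<kappa>\<bar> * (c2 * ?d u)"
    proof -
      have "\<bar>2 * \<kappa> * w u\<bar> = 2 * \<bar>\<kappa>\<bar> * w u" using w(1)[OF u] by (simp add: abs_mult)
      also have "\<dots> \<le> 2 * \<bar>\<kappa>\<bar> * (c2 * ?d u)" using w(2)[OF u] by (intro mult_left_mono) auto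
      finally show ?thesis .
    qed
    ultimately show ?thesis by (simp add: h'_def K0_def algebra_simps)
  qed
  have der: "(h has_real_derivative h' u) (at u)" if u: "u \<in> {a<..<b}" for u
  proof -
    have "(h has_real_derivative h' u) (at u within {a..b})"
      unfolding h_def using integral_has_real_derivative[OF conth'] u by auto
    moreover have "at u within {a..b} = at u"
      using u by (intro at_within_interior) (simp add: interior_atLeastAtMost_real)
    ultimately show ?thesis by simp
  qed
  \<comment> \<open>\<open>h\<close> vanishes at both ends and \<open>h'\<close> vanishes linearly there, so \<open>h\<close> vanishes quadratically.\<close>
  have h_le: "\<bar>h u\<bar> \<le> 4 * (K0 * L) / (b - a)\<^sup>2 * (?d u)\<^sup>2" if u: "u \<in> {a..b}" for u
  proof (rule le_end_dist_squareI[OF u ab])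
    have bd: "\<bar>integral {x..y} h'\<bar> \<le> B * (y - x)"
      if "a \<le> x" "x \<le> y" "y \<le> b" "\<And>s. s \<in> {x..y} \<Longrightarrow> \<bar>h' s\<bar> \<le> B" for x y B
    proof -
      have "norm (integral {x..y} h') \<le> B * (y - x)"
        by (rule integral_bound) (use that conth' in \<open>auto intro: continuous_on_subset\<close>)
      then show ?thesis by simp
    qed
    have le: "\<bar>h' s\<bar> \<le> K0 * L * (s - a)" "\<bar>h' s\<bar> \<le> K0 * L * (b - s)" if "s \<in> {a..b}" for s
      using h'_le[OF that] mult_left_mono[OF end_dist_le(1)[OF that] K0]
        mult_left_mono[OF end_dist_le(2)[OF that] K0] by (auto simp: L_def mult_ac)
    have KL: "K0 * L \<ge> 0" using K0 L by simp
    show "\<bar>h u\<bar> \<le> K0 * L * (u - a)\<^sup>2"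
    proof -
      have "\<bar>h u\<bar> \<le> (K0 * L * (u - a)) * (u - a)"
        unfolding h_def
      proof (rule bd)
        fix s assume s: "s \<in> {a..u}"
        have "K0 * L * (s - a) \<le> K0 * L * (u - a)" using s KL by (intro mult_left_mono) auto
        then show "\<bar>h' s\<bar> \<le> K0 * L * (u - a)" using le(1)[of s] s u by simp
      qed (use u in auto)
      then show ?thesis by (simp add: power2_eq_square mult.assoc)
    qed
    show "\<bar>h u\<bar> \<le> K0 * L * (b - u)\<^sup>2"
    proof -
      have "h u + integral {u..b} h' = h b"
        unfolding h_def using u inth' by (intro Henstock_Kurzweil_Integration.integral_combine) auto
      then have "\<bar>h u\<bar> = \<bar>integral {u..b} h'\<bar>" using hb by linarith
      also have "\<dots> \<le> (K0 * L * (b - u)) * (b - u)"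
      proof (rule bd)
        fix s assume s: "s \<in> {u..b}"
        have "K0 * L * (b - s) \<le> K0 * L * (b - u)" using s KL by (intro mult_left_mono) auto
        then show "\<bar>h' s\<bar> \<le> K0 * L * (b - u)" using le(2)[of s] s u by simp
      qed (use u in auto)
      finally show ?thesis by (simp add: power2_eq_square mult.assoc)
    qed
  qed (use K0 L in simp)
  define K where "K = max K0 (4 * (K0 * L) / (b - a)\<^sup>2)"
  have cost: "integral {a..b} (\<lambda>u. (h' u + 2 * \<kappa> * w u)\<^sup>2 * (2 * w u)) \<le> \<eta>"
  proof -
    have "integral {a..b} (\<lambda>u. (h' u + 2 * \<kappa> * w u)\<^sup>2 * (2 * w u)) \<le>
        integral {a..b} (\<lambda>u. 2 * c2 * c\<^sup>2 * \<rho> \<mu> u)"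
    proof (rule integral_le)
      fix u assume u: "u \<in> {a..b}"
      have "\<rho> \<mu> u * w u \<le> \<rho> \<mu> u * (c2 * ?d u)"
        using \<rho>0[OF \<mu> u] w[OF u] by (intro mult_left_mono) auto
      also have "\<dots> = c2 * ((?d u)\<^sup>2 / ((?d u)\<^sup>2 + \<mu>))"
        by (simp add: \<rho>_def power2_eq_square)
      also have "\<dots> \<le> c2 * 1"
        using c2 \<mu> pos[OF \<mu>, of u] by (intro mult_left_mono) (auto simp: divide_le_eq)
      finally have "2 * c\<^sup>2 * \<rho> \<mu> u * (\<rho> \<mu> u * w u) \<le> 2 * c\<^sup>2 * \<rho> \<mu> u * c2"
        using \<rho>0[OF \<mu> u] by (intro mult_left_mono) auto
      then show "(h' u + 2 * \<kappa> * w u)\<^sup>2 * (2 * w u) \<le> 2 * c2 * c\<^sup>2 * \<rho> \<mu> u"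
        by (simp add: h'_def power2_eq_square mult_ac)
    qed (auto intro!: integrable_continuous_interval continuous_intros conth' contw cont\<rho>[OF \<mu>])
    also have "\<dots> = 2 * c2 * c\<^sup>2 * I" by (simp add: I_def)
    also have "\<dots> = (8 * c2 * \<kappa>\<^sup>2 * S\<^sup>2) / I"
      using I by (simp add: c_def power2_eq_square)
    also have "\<dots> \<le> \<eta>"
      using I \<eta> by (simp add: field_simps)
    finally show ?thesis .
  qed
  show ?thesis
  proof (rule exI[of _ h], rule exI[of _ h'], rule exI[of _ K], intro conjI ballI)
    show "continuous_on {a..b} h"
      unfolding h_def by (rule indefinite_integral_continuous_1[OF inth'])
    show "K \<ge> 0" using K0 by (simp add: K_def)
    show "\<bar>h u\<bar> \<le> K * (?d u)\<^sup>2" if "u \<in> {a..b}" for u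
      by (rule order_trans[OF h_le[OF that] mult_right_mono]) (auto simp: K_def)
    show "\<bar>h' u\<bar> \<le> K * ?d u" if "u \<in> {a..b}" for u
      by (rule order_trans[OF h'_le[OF that] mult_right_mono])
        (use end_dist_nonneg[OF that] in \<open>auto simp: K_def\<close>)
  qed (use conth' der cost in auto)
qed

section \<open>Transition profiles of finite length\<close>

lemma sqrt_sqrt_power4: "0 \<le> c \<Longrightarrow> sqrt (sqrt c) ^ 4 = c"
  using power_mult[of "sqrt (sqrt c)" 2 2] by simp

text \<open>
  The function \<open>d powr (- 3 / 4)\<close> is integrable over \<open>[a, b]\<close>, where \<open>d = end_dist a b\<close>. A majorant is a multiple of the
  derivative of the difference of the fourth roots of \<open>u - a\<close> and \<open>b - u\<close>.
\<close>

lemma end_weight_integrable: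
  assumes ab: "a < b"
  obtains J where "J integrable_on {a..b}" "\<And>u. u \<in> {a..b} \<Longrightarrow> 0 \<le> J u"
    "\<And>u. u \<in> {a<..<b} \<Longrightarrow> 1 / sqrt (end_dist a b u * sqrt (end_dist a b u)) \<le> J u"
proof -
  define x where "x u = sqrt (sqrt (u - a))" for u
  define y where "y u = sqrt (sqrt (b - u))" for u
  define z where "z = sqrt (sqrt ((b - a) / 2))"
  have z: "z > 0" using ab by (simp add: z_def)
  have z4: "z ^ 4 = (b - a) / 2"
    using ab by (simp add: z_def sqrt_sqrt_power4)
  define J0 where "J0 u = inverse (4 * x u ^ 3) + inverse (4 * y u ^ 3)" for u
  have xy: "x u \<ge> 0" "y u \<ge> 0" "x u ^ 4 = u - a" "y u ^ 4 = b - u" if "u \<in> {a..b}" for u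
    using that by (simp_all add: x_def y_def sqrt_sqrt_power4)
  have xy_pos: "x u > 0" "y u > 0" if "u \<in> {a<..<b}" for u
    using that by (simp_all add: x_def y_def)
  have "(J0 has_integral ((x b - y b) - (x a - y a))) {a..b}"
  proof (rule fundamental_theorem_of_calculus_interior)
    show "continuous_on {a..b} (\<lambda>u. x u - y u)"
      unfolding x_def y_def by (intro continuous_intros)
    show "((\<lambda>u. x u - y u) has_vector_derivative J0 u) (at u)" if u: "u \<in> {a<..<b}" for u
    proof -
      have sq: "sqrt (u - a) = (x u)\<^sup>2" "sqrt (b - u) = (y u)\<^sup>2"
        using u by (simp_all add: x_def y_def)
      have "((\<lambda>u. x u - y u) has_real_derivative
          (inverse (sqrt (sqrt (u - a))) / 2 * (inverse (sqrt (u - a)) / 2) +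
           inverse (sqrt (sqrt (b - u))) / 2 * (inverse (sqrt (b - u)) / 2))) (at u)"
        unfolding x_def y_def using u by (auto intro!: derivative_eq_intros)
      moreover have "inverse (sqrt (sqrt (u - a))) / 2 * (inverse (sqrt (u - a)) / 2) +
           inverse (sqrt (sqrt (b - u))) / 2 * (inverse (sqrt (b - u)) / 2) = J0 u"
        unfolding J0_def x_def[symmetric] y_def[symmetric] unfolding sq
        by (simp add: field_simps power3_eq_cube power2_eq_square)
      ultimately show ?thesis by (simp add: has_real_derivative_iff_has_vector_derivative)
    qed
  qed (use ab in auto)
  then have int: "(\<lambda>u. 4 / z ^ 3 * J0 u) integrable_on {a..b}"
    using has_integral_mult_right has_integral_integrable by blast
  show ?thesis
  proof (rule that[OF int])
    show "0 \<le> 4 / z ^ 3 * J0 u" if "u \<in> {a..b}" for u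
      using z xy[OF that] by (simp add: J0_def)
    show "1 / sqrt (end_dist a b u * sqrt (end_dist a b u)) \<le> 4 / z ^ 3 * J0 u"
      if u: "u \<in> {a<..<b}" for u
    proof -
      note p = xy_pos[OF u]
      have u': "u \<in> {a..b}" using u by simp
      have d: "end_dist a b u = ((x u * y u)\<^sup>2)\<^sup>2"
        using xy(3,4)[OF u'] by (simp add: end_dist_def power_mult_distrib flip: power_mult)
      have sd: "sqrt (end_dist a b u) = (x u * y u)\<^sup>2"
        unfolding d by (rule real_sqrt_unique) auto
      have eq: "sqrt (end_dist a b u * sqrt (end_dist a b u)) = (x u * y u) ^ 3"
        unfolding sd unfolding d
        by (rule real_sqrt_unique) (use p in \<open>auto simp flip: power_mult power_add\<close>)
      have "z ^ 3 \<le> x u ^ 3 + y u ^ 3"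
      proof -
        have "z ^ 4 \<le> x u ^ 4 \<or> z ^ 4 \<le> y u ^ 4"
          unfolding z4 xy(3,4)[OF u'] by (auto simp: field_simps)
        then have "z \<le> x u \<or> z \<le> y u"
          using p z power_mono_iff[of z "x u" 4] power_mono_iff[of z "y u" 4] by auto
        then show ?thesis
        proof
          assume "z \<le> x u"
          then have "z ^ 3 \<le> x u ^ 3" using z by (intro power_mono) auto
          then show ?thesis using p by (simp add: add_increasing2)
        next
          assume "z \<le> y u"
          then have "z ^ 3 \<le> y u ^ 3" using z by (intro power_mono) auto
          then show ?thesis using p by (simp add: add_increasing)
        qed
      qed
      then have "1 \<le> (x u ^ 3 + y u ^ 3) / z ^ 3" using z by simp
      then have "1 / (x u * y u) ^ 3 \<le> (x u ^ 3 + y u ^ 3) / z ^ 3 / (x u * y u) ^ 3"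
        using p by (intro divide_right_mono) auto
      also have "\<dots> = 4 / z ^ 3 * J0 u"
        using p z by (simp add: J0_def field_simps)
      finally show ?thesis unfolding eq .
    qed
  qed
qed

text \<open>
  A \<open>C\<^sup>2\<close> function \<open>V\<close> on the line, with derivatives \<open>V1\<close> and \<open>V2\<close>, that is constantly \<open>x\<close> up to
  time 0 and constantly \<open>y\<close> from time \<open>T\<close> on. The derivatives are carried as explicit arguments.
\<close>

definition profile ::
  "real \<Rightarrow> real \<Rightarrow> real \<Rightarrow> (real \<Rightarrow> real) \<Rightarrow> (real \<Rightarrow> real) \<Rightarrow> (real \<Rightarrow> real) \<Rightarrow> bool" where
  "profile x y T V V1 V2 \<longleftrightarrow> 0 \<le> T \<and>
     (\<forall>t. (V has_real_derivative V1 t) (at t)) \<and> (\<forall>t. (V1 has_real_derivative V2 t) (at t)) \<and>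
     continuous_on UNIV V2 \<and>
     (\<forall>t\<le>0. V t = x \<and> V1 t = 0 \<and> V2 t = 0) \<and> (\<forall>t\<ge>T. V t = y \<and> V1 t = 0 \<and> V2 t = 0)"

text \<open>
  If \<open>u x = V ((norm x - r) / \<epsilon>)\<close>, the energy density of \<open>u\<close> is \<open>1 / \<epsilon>\<close> times this quantity
  at the stretched variable.
\<close>

definition profile_density :: "(real \<Rightarrow> real) \<Rightarrow> (real \<Rightarrow> real) \<Rightarrow> (real \<Rightarrow> real) \<Rightarrow> real \<Rightarrow> real" where
  "profile_density W V V1 t = (V1 t)\<^sup>2 + W (V t)"

text \<open>
  The residual \<open>2 \<epsilon> \<Delta>u - W'(u) / \<epsilon>\<close> of the same \<open>u\<close>, with the mean curvature of the level sets
  replaced by the constant \<open>\<kappa>\<close>.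
\<close>

definition profile_defect ::
  "(real \<Rightarrow> real) \<Rightarrow> real \<Rightarrow> real \<Rightarrow> (real \<Rightarrow> real) \<Rightarrow> (real \<Rightarrow> real) \<Rightarrow> (real \<Rightarrow> real) \<Rightarrow> real \<Rightarrow> real" where
  "profile_defect W \<epsilon> \<kappa> V V1 V2 t = (2 * V2 t - deriv W (V t)) / \<epsilon> + 2 * \<kappa> * V1 t"

text \<open>
  For \<open>s = sqrt (W V)\<close> and \<open>F = V'\<close> this compares the energy density of the profile with multiples of
  \<open>V'\<close>, which can be integrated by substitution.
\<close>

lemma energy_of_first_order_profile:
  fixes s F \<tau> :: real
  assumes "0 \<le> s" "0 \<le> F" "s \<le> 2 * F" "\<bar>F - s\<bar> \<le> \<tau>"
  shows "2 * s * F \<le> F\<^sup>2 + s\<^sup>2" "F\<^sup>2 + s\<^sup>2 \<le> (2 * s + \<tau>) * F"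
proof -
  have eq: "F\<^sup>2 + s\<^sup>2 = 2 * s * F + \<bar>F - s\<bar> * \<bar>F - s\<bar>"
    by (simp add: power2_eq_square algebra_simps)
  show "2 * s * F \<le> F\<^sup>2 + s\<^sup>2" unfolding eq by simp
  have "\<bar>F - s\<bar> * \<bar>F - s\<bar> \<le> \<tau> * F" using assms by (intro mult_mono) auto
  then show "F\<^sup>2 + s\<^sup>2 \<le> (2 * s + \<tau>) * F" unfolding eq by (simp add: algebra_simps)
qed

text \<open>
  A nonnegative \<open>C\<^sup>2\<close> potential with two nondegenerate consecutive wells \<open>a\<close> and \<open>b\<close>.
\<close>

locale double_well =
  fixes W :: "real \<Rightarrow> real" and a b :: real
  assumes W_C2: "C2 W" and W_nonneg: "\<And>s. W s \<ge> 0"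
    and wells: "a < b" "W a = 0" "W b = 0" "\<And>s. s \<in> {a<..<b} \<Longrightarrow> W s > 0"
    and nondeg: "deriv (deriv W) a > 0" "deriv (deriv W) b > 0"
begin

lemma continuous_on_W: "continuous_on S W"
  using C2_real_derivs(1)[OF W_C2] DERIV_isCont by (blast intro: continuous_at_imp_continuous_on)

lemma continuous_on_W': "continuous_on S (deriv W)"
  using C2_real_derivs(2)[OF W_C2] DERIV_isCont by (blast intro: continuous_at_imp_continuous_on)

text \<open>
  The constants \<open>K\<close>, \<open>C\<close> and \<open>B\<close> depend on \<open>W\<close>, \<open>a\<close> and \<open>b\<close> only: the curvature \<open>\<kappa>\<close> and the accuracy \<open>\<eta>\<close>
  affect only how small \<open>\<epsilon>\<close> has to be. This uniformity in \<open>\<kappa>\<close> is what allows small spheres later.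
\<close>

lemma transition_exists:
  shows "\<exists>K C B. \<forall>\<kappa> \<eta>. 0 < \<eta> \<longrightarrow>
    (\<forall>\<^sub>F \<epsilon> in at_right 0. \<exists>T V V1 V2. profile a b T V V1 V2 \<and> T \<le> K / sqrt \<epsilon> \<and>
      (\<forall>t. (V1 t)\<^sup>2 \<le> B) \<and>
      sigma_W W a b \<le> integral {0..T} (profile_density W V V1) \<and>
      integral {0..T} (profile_density W V V1) \<le> sigma_W W a b + \<eta> \<and>
      integral {0..T} (\<lambda>t. (profile_defect W \<epsilon> \<kappa> V V1 V2 t)\<^sup>2 * profile_density W V V1 t) \<le> C)"
proof -
  let ?d = "end_dist a b"
  define w where "w u = sqrt (W u)" for u
  have w2: "(w u)\<^sup>2 = W u" and w0: "0 \<le> w u" for u using W_nonneg by (simp_all add: w_def)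
  have contw: "continuous_on S w" for S unfolding w_def by (intro continuous_intros continuous_on_W)
  have W'_ends: "deriv W a = 0" "deriv W b = 0"
    using deriv_zero_at_minimum[OF W_C2 W_nonneg] wells by auto
  obtain c1 c2 where c: "c1 > 0" "c2 > 0"
    and c1: "\<And>u. u \<in> {a..b} \<Longrightarrow> c1 * ?d u \<le> w u"
    and c2: "\<And>u. u \<in> {a..b} \<Longrightarrow> w u \<le> c2 * ?d u"
    unfolding w_def using sqrt_double_well_comparable[OF W_C2 W_nonneg wells nondeg] by metis
  have wb: "\<forall>u\<in>{a..b}. 0 \<le> w u \<and> w u \<le> c2 * ?d u" using w0 c2 by blast
  obtain J where J: "J integrable_on {a..b}" "\<And>u. u \<in> {a..b} \<Longrightarrow> 0 \<le> J u"
    "\<And>u. u \<in> {a<..<b} \<Longrightarrow> 1 / sqrt (?d u * sqrt (?d u)) \<le> J u"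
    using end_weight_integrable[OF wells(1)] by metis
  \<comment> \<open>The part of \<open>h\<close> that makes the transit time finite; it does not depend on \<open>\<kappa>\<close>.\<close>
  define p where "p u = ?d u * sqrt (?d u)" for u
  define p' where "p' u = 3 / 2 * sqrt (?d u) * (a + b - 2 * u)" for u
  have contp: "continuous_on S p" for S unfolding p_def by (intro continuous_intros)
  have contp': "continuous_on S p'" for S unfolding p'_def by (intro continuous_intros)
  have p_nonneg: "0 \<le> p u" if "u \<in> {a..b}" for u
    using end_dist_nonneg[OF that] by (simp add: p_def)
  have p_pos: "0 < p u" if "u \<in> {a<..<b}" for u
    using end_dist_pos[OF that] by (simp add: p_def)
  have p_der: "(p has_real_derivative p' u) (at u)" if "u \<in> {a<..<b}" for u
  proof -
    note d = end_dist_pos[OF that]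
    have assoc: "i / 2 * D * e = D / 2 * (i * e)" for i D e :: real by simp
    have "((\<lambda>u. sqrt (?d u)) has_real_derivative inverse (sqrt (?d u)) / 2 * (a + b - 2 * u)) (at u)"
      by (rule DERIV_chain2[OF DERIV_real_sqrt[OF d] DERIV_end_dist])
    from DERIV_mult[OF DERIV_end_dist this]
    have "(p has_real_derivative (a + b - 2 * u) * sqrt (?d u) +
        inverse (sqrt (?d u)) / 2 * (a + b - 2 * u) * ?d u) (at u)"
      unfolding p_def .
    moreover have "inverse (sqrt (?d u)) / 2 * (a + b - 2 * u) * ?d u = (a + b - 2 * u) / 2 * sqrt (?d u)"
    proof -
      have eq: "inverse (sqrt (?d u)) * ?d u = sqrt (?d u)"
        using d by (simp add: field_simps flip: power2_eq_square)
      have "inverse (sqrt (?d u)) / 2 * (a + b - 2 * u) * ?d u =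
          (a + b - 2 * u) / 2 * (inverse (sqrt (?d u)) * ?d u)"
        by (rule assoc)
      then show ?thesis unfolding eq .
    qed
    then have "(a + b - 2 * u) * sqrt (?d u) + inverse (sqrt (?d u)) / 2 * (a + b - 2 * u) * ?d u = p' u"
      by (simp only: p'_def) (simp add: field_simps)
    ultimately show ?thesis by simp
  qed
  define Cp where "Cp = integral {a..b} (\<lambda>u. (p' u)\<^sup>2 * (2 * w u))"
  define K where "K = integral {a..b} J"
  \<comment> \<open>Twice the cost 1 of the corrector, twice the cost of \<open>p\<close>, and a margin for the limit in \<open>\<epsilon>\<close>.\<close>
  define C where "C = 2 + 2 * Cp + 1"
  have "bounded (W ` {a..b})"
    by (intro compact_imp_bounded compact_continuous_image continuous_on_W) auto
  then obtain MW where M: "\<forall>y\<in>W ` {a..b}. norm y \<le> MW" unfolding bounded_iff by (elim exE)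
  have MW: "W u \<le> MW" if "u \<in> {a..b}" for u
    using M[rule_format, OF imageI[OF that]] unfolding real_norm_def by linarith
  define B where "B = MW + 1"
  show ?thesis
  proof (rule exI[of _ K], rule exI[of _ C], rule exI[of _ B], intro allI impI)
    fix \<kappa> \<eta> :: real assume \<eta>: "\<eta> > 0"
    obtain h0 h0' K0 where h0: "continuous_on {a..b} h0 \<and> continuous_on {a..b} h0' \<and>
      (\<forall>u\<in>{a<..<b}. (h0 has_real_derivative h0' u) (at u)) \<and> 0 \<le> K0 \<and>
      (\<forall>u\<in>{a..b}. \<bar>h0 u\<bar> \<le> K0 * (?d u)\<^sup>2) \<and> (\<forall>u\<in>{a..b}. \<bar>h0' u\<bar> \<le> K0 * ?d u) \<and>
      integral {a..b} (\<lambda>u. (h0' u + 2 * \<kappa> * w u)\<^sup>2 * (2 * w u)) \<le> 1"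
      using curvature_corrector[where \<kappa> = \<kappa>, OF wells(1) contw c(2) wb zero_less_one] by (elim exE)
    then have conth0: "continuous_on {a..b} h0" and conth0': "continuous_on {a..b} h0'" and K0: "K0 \<ge> 0"
      and h0_cost: "integral {a..b} (\<lambda>u. (h0' u + 2 * \<kappa> * w u)\<^sup>2 * (2 * w u)) \<le> 1" by blast+
    have h0_der: "(h0 has_real_derivative h0' u) (at u)" if "u \<in> {a<..<b}" for u
      using h0 that by blast
    have h0_le: "\<bar>h0 u\<bar> \<le> K0 * (?d u)\<^sup>2" and h0'_le: "\<bar>h0' u\<bar> \<le> K0 * ?d u" if "u \<in> {a..b}" for u
      using h0 that by blast+
    define h where "h u = h0 u + p u" for u
    define h' where "h' u = h0' u + p' u" for u
    have conth: "continuous_on {a..b} h" unfolding h_def by (intro continuous_intros conth0 contp)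
    have conth': "continuous_on {a..b} h'" unfolding h'_def by (intro continuous_intros conth0' contp')
    have h_ends: "h a = 0" "h b = 0" "h' a = 0" "h' b = 0"
      using h0_le[of a] h0_le[of b] h0'_le[of a] h0'_le[of b] wells(1)
      by (simp_all add: h_def h'_def p_def p'_def)
    have "bounded (h ` {a..b})"
      by (intro compact_imp_bounded compact_continuous_image conth) auto
    then obtain H0 where M: "\<forall>y\<in>h ` {a..b}. norm y \<le> H0" unfolding bounded_iff by (elim exE)
    have H0: "\<bar>h u\<bar> \<le> H0" if "u \<in> {a..b}" for u
      using M[rule_format, OF imageI[OF that]] unfolding real_norm_def .
    define H where "H = max 1 H0"
    have H: "H > 0" "\<And>u. u \<in> {a..b} \<Longrightarrow> \<bar>h u\<bar> \<le> H" using H0 by (force simp: H_def)+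
    \<comment> \<open>The cost of the profile will be at most the integral of \<open>\<phi> \<epsilon>\<close> over \<open>[a, b]\<close>.\<close>
    define \<phi> where "\<phi> \<epsilon> u = (h' u + 2 * \<kappa> * sqrt (W u + \<epsilon> * h u))\<^sup>2 * (2 * w u + sqrt (\<epsilon> * H))" for \<epsilon> u
    have "continuous_on {0..} (\<lambda>\<epsilon>. integral (cbox a b) (\<phi> \<epsilon>))"
    proof (rule integral_continuous_on_param)
      have "continuous_on ({0..} \<times> cbox a b) (\<lambda>x. h' (snd x))"
        by (rule continuous_on_compose2[OF conth' continuous_on_snd]) (auto intro: continuous_intros)
      moreover have "continuous_on ({0..} \<times> cbox a b) (\<lambda>x. h (snd x))"
        by (rule continuous_on_compose2[OF conth continuous_on_snd]) (auto intro: continuous_intros)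
      moreover have "continuous_on ({0..} \<times> cbox a b) (\<lambda>x. w (snd x))"
        by (rule continuous_on_compose2[OF contw continuous_on_snd]) (auto intro: continuous_intros)
      moreover have "continuous_on ({0..} \<times> cbox a b) (\<lambda>x. W (snd x))"
        by (rule continuous_on_compose2[OF continuous_on_W continuous_on_snd]) (auto intro: continuous_intros)
      ultimately show "continuous_on ({0..} \<times> cbox a b) (\<lambda>(\<epsilon>, u). \<phi> \<epsilon> u)"
        unfolding \<phi>_def case_prod_beta by (intro continuous_intros)
    qed
    then have lim: "((\<lambda>\<epsilon>. integral {a..b} (\<phi> \<epsilon>)) \<longlongrightarrow> integral {a..b} (\<phi> 0)) (at_right 0)"
      unfolding continuous_on_def by (auto intro: tendsto_within_subset)
    have "integral {a..b} (\<phi> 0) \<le>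
        integral {a..b} (\<lambda>u. 2 * ((h0' u + 2 * \<kappa> * w u)\<^sup>2 * (2 * w u)) + 2 * ((p' u)\<^sup>2 * (2 * w u)))"
    proof (rule integral_le)
      show "\<phi> 0 integrable_on {a..b}"
        unfolding \<phi>_def
        by (intro integrable_continuous_interval continuous_intros conth' continuous_on_W conth contw)
      fix u assume "u \<in> {a..b}"
      have "(h0' u + p' u + 2 * \<kappa> * w u)\<^sup>2 \<le> 2 * (h0' u + 2 * \<kappa> * w u)\<^sup>2 + 2 * (p' u)\<^sup>2"
        using zero_le_power2[of "h0' u + 2 * \<kappa> * w u - p' u"]
        by (simp add: power2_eq_square algebra_simps)
      from mult_right_mono[OF this, of "2 * w u"] w0[of u]
      show "\<phi> 0 u \<le> 2 * ((h0' u + 2 * \<kappa> * w u)\<^sup>2 * (2 * w u)) + 2 * ((p' u)\<^sup>2 * (2 * w u))"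
        by (simp add: \<phi>_def h'_def w_def algebra_simps)
    qed (intro integrable_continuous_interval continuous_intros conth0' contp' contw)
    also have "\<dots> = 2 * integral {a..b} (\<lambda>u. (h0' u + 2 * \<kappa> * w u)\<^sup>2 * (2 * w u)) + 2 * Cp"
      unfolding Cp_def
      by (subst integral_add)
        (simp_all only: integral_mult_right,
          auto intro!: integrable_continuous_interval continuous_intros conth0' contp' contw)
    also have "\<dots> < C" using h0_cost by (simp add: C_def)
    finally have ev1: "\<forall>\<^sub>F \<epsilon> in at_right 0. integral {a..b} (\<phi> \<epsilon>) < C"
      using order_tendstoD(2)[OF lim] by blast
    have small: "\<forall>\<^sub>F \<epsilon> in at_right 0. f \<epsilon> < y" if "isCont f 0" "f 0 < y" for f :: "real \<Rightarrow> real" and y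
      using that by (metis order_tendstoD(2) filterlim_at_split isCont_def)
    have ev2: "\<forall>\<^sub>F \<epsilon> in at_right 0. \<epsilon> * K0 < c1\<^sup>2 / 2" by (rule small) (use c in auto)
    have ev3: "\<forall>\<^sub>F \<epsilon> in at_right 0. \<epsilon> * H < 1" by (rule small) auto
    have ev4: "\<forall>\<^sub>F \<epsilon> in at_right 0. sqrt (\<epsilon> * H) * (b - a) < \<eta>"
      by (rule small) (use \<eta> in \<open>auto intro!: continuous_intros\<close>)
    show "\<forall>\<^sub>F \<epsilon> in at_right 0. \<exists>T V V1 V2. profile a b T V V1 V2 \<and> T \<le> K / sqrt \<epsilon> \<and>
      (\<forall>t. (V1 t)\<^sup>2 \<le> B) \<and>
      sigma_W W a b \<le> integral {0..T} (profile_density W V V1) \<and>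
      integral {0..T} (profile_density W V V1) \<le> sigma_W W a b + \<eta> \<and>
      integral {0..T} (\<lambda>t. (profile_defect W \<epsilon> \<kappa> V V1 V2 t)\<^sup>2 * profile_density W V V1 t) \<le> C"
      using ev1 ev2 ev3 ev4 eventually_at_right_less[of 0]
    proof eventually_elim
      case (elim \<epsilon>)
      then have \<epsilon>: "\<epsilon> > 0" by simp
      define g where "g u = W u + \<epsilon> * h u" for u
      define g' where "g' u = deriv W u + \<epsilon> * h' u" for u
      have contg: "continuous_on {a..b} g" unfolding g_def by (intro continuous_intros continuous_on_W conth)
      have contg': "continuous_on {a..b} g'" unfolding g'_def by (intro continuous_intros continuous_on_W' conth')
      \<comment> \<open>Since \<open>h0\<close> is bounded by a multiple of \<open>d\<^sup>2\<close>, hence of \<open>W\<close>, it cannot spoil positivity.\<close>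
      have g_lower: "W u / 2 + \<epsilon> * p u \<le> g u" if u: "u \<in> {a..b}" for u
      proof -
        have "\<epsilon> * \<bar>h0 u\<bar> \<le> \<epsilon> * (K0 * (?d u)\<^sup>2)" using h0_le[OF u] \<epsilon> by (intro mult_left_mono) auto
        also have "\<dots> = (\<epsilon> * K0) * (?d u)\<^sup>2" by simp
        also have "\<dots> \<le> (c1\<^sup>2 / 2) * (?d u)\<^sup>2" using elim(2) by (intro mult_right_mono) auto
        also have "\<dots> = (c1 * ?d u)\<^sup>2 / 2" by (simp add: power_mult_distrib)
        also have "\<dots> \<le> (w u)\<^sup>2 / 2"
          using c1[OF u] c(1) end_dist_nonneg[OF u] by (intro divide_right_mono power_mono) auto
        finally have "\<epsilon> * \<bar>h0 u\<bar> \<le> W u / 2" by (simp add: w2)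
        moreover have "- (\<epsilon> * \<bar>h0 u\<bar>) \<le> \<epsilon> * h0 u"
          using \<epsilon> abs_ge_minus_self[of "\<epsilon> * h0 u"] by (simp add: abs_mult)
        ultimately show ?thesis by (simp add: g_def h_def algebra_simps)
      qed
      have g_ge: "\<epsilon> * p u \<le> g u" "W u / 2 \<le> g u" "0 \<le> g u" if "u \<in> {a..b}" for u
        using g_lower[OF that] W_nonneg[of u] mult_nonneg_nonneg[OF less_imp_le[OF \<epsilon>] p_nonneg[OF that]]
        by linarith+
      have g_pos: "0 < g u" if "u \<in> {a<..<b}" for u
        using g_ge(1)[of u] mult_pos_pos[OF \<epsilon> p_pos[OF that]] that by simp
      then have pos: "\<forall>u\<in>{a<..<b}. 0 < g u" by blast
      have der: "\<forall>u\<in>{a<..<b}. (g has_real_derivative g' u) (at u)"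
        unfolding g_def g'_def h_def h'_def
        by (intro ballI DERIV_add DERIV_cmult C2_real_derivs(1)[OF W_C2] h0_der p_der)
      have g_ends: "g a = 0" "g b = 0" "g' a = 0" "g' b = 0"
        using h_ends wells W'_ends by (simp_all add: g_def g'_def)
      have bound: "1 / sqrt (g u) \<le> 1 / sqrt \<epsilon> * J u" if u: "u \<in> {a..b}" for u
      proof (cases "u \<in> {a<..<b}")
        case True
        have "1 / sqrt (g u) \<le> 1 / sqrt (\<epsilon> * p u)"
          using g_ge(1)[OF u] p_pos[OF True] \<epsilon> g_pos[OF True] by (intro divide_left_mono) auto
        also have "\<dots> = 1 / sqrt \<epsilon> * (1 / sqrt (p u))" by (simp add: real_sqrt_mult)
        also have "\<dots> \<le> 1 / sqrt \<epsilon> * J u"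
          using J(3)[OF True] \<epsilon> unfolding p_def by (intro mult_left_mono) auto
        finally show ?thesis .
      next
        case False
        then have "u = a \<or> u = b" using u by auto
        then have "g u = 0" using g_ends by auto
        then show ?thesis using J(2)[OF u] \<epsilon> by simp
      qed
      have intJ: "(\<lambda>u. 1 / sqrt \<epsilon> * J u) integrable_on {a..b}"
        using integrable_cmul[OF J(1), of "1 / sqrt \<epsilon>"] by simp
      have int: "(\<lambda>u. 1 / sqrt (g u)) integrable_on {a..b}"
      proof (rule measurable_bounded_by_integrable_imp_integrable[OF _ intJ])
        have "g \<in> borel_measurable (lebesgue_on {a..b})"
          by (rule continuous_imp_measurable_on_sets_lebesgue[OF contg]) auto
        then show "(\<lambda>u. 1 / sqrt (g u)) \<in> borel_measurable (lebesgue_on {a..b})"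
          by measurable
        show "norm (1 / sqrt (g u)) \<le> 1 / sqrt \<epsilon> * J u" if "u \<in> {a..b}" for u
          using bound[OF that] g_ge(3)[OF that] by simp
      qed auto
      define T where "T = integral {a..b} (\<lambda>u. 1 / sqrt (g u))"
      have T: "0 < T" and "\<exists>q. (\<forall>t. q t \<in> {a..b}) \<and> (\<forall>t\<le>0. q t = a) \<and> (\<forall>t\<ge>T. q t = b) \<and>
          (\<forall>t. (q has_real_derivative sqrt (g (q t))) (at t)) \<and>
          (\<forall>t. ((\<lambda>t. sqrt (g (q t))) has_real_derivative g' (q t) / 2) (at t))"
        using finite_time_heteroclinic[OF wells(1) contg contg' pos der g_ends int, folded T_def]
        by blast+
      then obtain q where "(\<forall>t. q t \<in> {a..b}) \<and> (\<forall>t\<le>0. q t = a) \<and> (\<forall>t\<ge>T. q t = b) \<and>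
          (\<forall>t. (q has_real_derivative sqrt (g (q t))) (at t)) \<and>
          (\<forall>t. ((\<lambda>t. sqrt (g (q t))) has_real_derivative g' (q t) / 2) (at t))"
        by (elim exE)
      then have q: "q t \<in> {a..b}" "t \<le> 0 \<Longrightarrow> q t = a" "t \<ge> T \<Longrightarrow> q t = b"
        and q1: "(q has_real_derivative sqrt (g (q t))) (at t)"
        and q2: "((\<lambda>t. sqrt (g (q t))) has_real_derivative g' (q t) / 2) (at t)" for t
        by blast+
      have contq: "continuous_on S q" for S
        using q1 DERIV_isCont by (blast intro: continuous_at_imp_continuous_on)
      define F where "F u = sqrt (g u)" for u
      have F0: "0 \<le> F u" and F2: "(F u)\<^sup>2 = W u + \<epsilon> * h u" if "u \<in> {a..b}" for u
        using g_ge(3)[OF that] by (simp_all add: F_def g_def)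
      have contF: "continuous_on {a..b} F" unfolding F_def by (intro continuous_intros contg)
      define \<tau> where "\<tau> = sqrt (\<epsilon> * H)"
      have \<tau>: "0 \<le> \<tau>" "\<tau>\<^sup>2 = \<epsilon> * H" using \<epsilon> H by (simp_all add: \<tau>_def)
      have close: "w u \<le> 2 * F u" "\<bar>F u - w u\<bar> \<le> \<tau>" if u: "u \<in> {a..b}" for u
      proof -
        have "(w u)\<^sup>2 \<le> (2 * F u)\<^sup>2"
          using g_ge(2,3)[OF u] F2[OF u] w2[of u] W_nonneg[of u]
          by (simp add: power_mult_distrib g_def)
        then show "w u \<le> 2 * F u" by (rule power2_le_imp_le) (use F0[OF u] in simp)
        have "\<bar>\<epsilon> * h u\<bar> \<le> \<tau>\<^sup>2" using H(2)[OF u] \<epsilon> by (simp add: \<tau> abs_mult)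
        then have "(F u)\<^sup>2 \<le> (w u)\<^sup>2 + \<tau>\<^sup>2" "(w u)\<^sup>2 \<le> (F u)\<^sup>2 + \<tau>\<^sup>2"
          using F2[OF u] w2[of u] by linarith+
        moreover have "0 \<le> 2 * w u * \<tau>" "0 \<le> 2 * F u * \<tau>" using F0[OF u] w0[of u] \<tau> by auto
        ultimately have "(F u)\<^sup>2 \<le> (w u + \<tau>)\<^sup>2" "(w u)\<^sup>2 \<le> (F u + \<tau>)\<^sup>2"
          unfolding power2_sum by linarith+
        then have "F u \<le> w u + \<tau>" "w u \<le> F u + \<tau>"
          using F0[OF u] w0[of u] \<tau>(1) power2_le_imp_le[of "F u" "w u + \<tau>"]
            power2_le_imp_le[of "w u" "F u + \<tau>"] by linarith+
        then show "\<bar>F u - w u\<bar> \<le> \<tau>" by linarith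
      qed
      let ?e = "profile_density W q (\<lambda>t. F (q t))"
      let ?A = "profile_defect W \<epsilon> \<kappa> q (\<lambda>t. F (q t)) (\<lambda>t. g' (q t) / 2)"
      have e: "2 * w (q t) * F (q t) \<le> ?e t" "?e t \<le> (2 * w (q t) + \<tau>) * F (q t)" for t
        using energy_of_first_order_profile[OF w0 F0[OF q(1)] close[OF q(1)], of t]
        by (simp_all add: profile_density_def w2)
      have A: "?A t = h' (q t) + 2 * \<kappa> * F (q t)" for t
      proof -
        have "2 * (g' (q t) / 2) - deriv W (q t) = \<epsilon> * h' (q t)"
          unfolding g'_def by (simp add: field_simps)
        then show ?thesis using \<epsilon> by (simp add: profile_defect_def)
      qed
      \<comment> \<open>All integrals along the profile become integrals over \<open>[a, b]\<close>.\<close>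
      have subst: "((\<lambda>t. f (q t) * F (q t)) has_integral integral {a..b} f) {0..T}"
        if "continuous_on {a..b} f" for f
      proof -
        have "((\<lambda>t. F (q t) *\<^sub>R f (q t)) has_integral integral {q 0..q T} f) {0..T}"
          by (rule has_integral_substitution[of 0 T q a b])
            (use T q q1 that wells(1) in \<open>auto simp: F_def intro: has_field_derivative_at_within\<close>)
        then show ?thesis using q(2)[of 0] q(3)[of T] by (simp add: mult.commute)
      qed
      have contFq: "continuous_on S (\<lambda>t. F (q t))" for S
        by (rule continuous_on_compose2[OF contF contq]) (use q(1) in auto)
      have conte: "continuous_on S ?e" for S
        unfolding profile_density_def
        by (intro continuous_intros contFq continuous_on_compose2[OF continuous_on_W contq]) auto
      have contA: "continuous_on S ?A" for S
        unfolding A by (intro continuous_intros contFq continuous_on_compose2[OF conth' contq]) (use q(1) in auto)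
      have sigma: "sigma_W W a b = integral {a..b} (\<lambda>u. 2 * w u)"
        by (simp add: sigma_W_def w_def)
      have contf: "continuous_on {a..b} (\<lambda>u. 2 * w u + \<tau>)" "continuous_on {a..b} (\<lambda>u. 2 * w u)"
        "continuous_on {a..b} (\<phi> \<epsilon>)"
        unfolding \<phi>_def by (intro continuous_intros contw conth' continuous_on_W conth)+
      show ?case
      proof (intro exI conjI)
        show "profile a b T q (\<lambda>t. F (q t)) (\<lambda>t. g' (q t) / 2)"
          unfolding profile_def F_def
          using T q q1 q2 g_ends
          by (auto intro!: continuous_intros continuous_on_compose2[OF contg' contq])
        have "T \<le> integral {a..b} (\<lambda>u. 1 / sqrt \<epsilon> * J u)"
          unfolding T_def by (rule integral_le[OF int intJ bound])
        also have "\<dots> = K / sqrt \<epsilon>" by (simp add: K_def)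
        finally show "T \<le> K / sqrt \<epsilon>" .
        show "\<forall>t. (F (q t))\<^sup>2 \<le> B"
        proof
          fix t
          have "\<epsilon> * h (q t) \<le> \<epsilon> * H" using H(2)[OF q(1), of t] \<epsilon> by (intro mult_left_mono) auto
          then show "(F (q t))\<^sup>2 \<le> B"
            using F2[OF q(1), of t] MW[OF q(1), of t] elim(3) by (simp add: B_def)
        qed
        show "sigma_W W a b \<le> integral {0..T} ?e"
          unfolding sigma integral_unique[OF subst[OF contf(2)], symmetric]
          using e(1) by (intro integral_le integrable_continuous_interval conte
              has_integral_integrable[OF subst[OF contf(2)]]) auto
        have "integral {0..T} ?e \<le> integral {0..T} (\<lambda>t. (2 * w (q t) + \<tau>) * F (q t))"
          using e(2) by (intro integral_le integrable_continuous_interval conte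
              has_integral_integrable[OF subst[OF contf(1)]]) auto
        also have "\<dots> = integral {a..b} (\<lambda>u. 2 * w u + \<tau>)"
          by (rule integral_unique[OF subst[OF contf(1)]])
        also have "\<dots> = sigma_W W a b + \<tau> * (b - a)"
          unfolding sigma using wells(1)
          by (subst integral_add) (auto intro!: integrable_continuous_interval contw)
        finally show "integral {0..T} ?e \<le> sigma_W W a b + \<eta>"
          using elim(4) by (simp add: \<tau>_def)
        have "integral {0..T} (\<lambda>t. (?A t)\<^sup>2 * ?e t) \<le> integral {0..T} (\<lambda>t. \<phi> \<epsilon> (q t) * F (q t))"
        proof (rule integral_le)
          show "(?A t)\<^sup>2 * ?e t \<le> \<phi> \<epsilon> (q t) * F (q t)" for t
          proof -
            have \<phi>: "\<phi> \<epsilon> (q t) = (?A t)\<^sup>2 * (2 * w (q t) + \<tau>)"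
              unfolding A unfolding \<phi>_def \<tau>_def F_def g_def ..
            show ?thesis
              unfolding \<phi> mult.assoc[of _ "2 * w (q t) + \<tau>"]
              by (rule mult_left_mono[OF e(2) zero_le_power2])
          qed
        qed (intro integrable_continuous_interval continuous_intros conte contA
              has_integral_integrable[OF subst[OF contf(3)]])+
        also have "\<dots> = integral {a..b} (\<phi> \<epsilon>)"
          by (rule integral_unique[OF subst[OF contf(3)]])
        finally show "integral {0..T} (\<lambda>t. (?A t)\<^sup>2 * ?e t) \<le> C" using elim(1) by simp
      qed
    qed
  qed
qed

end

section \<open>Concatenation and reversal of profiles\<close>

text \<open>
  Integrals along profiles of a quantity \<open>f\<close> depending on the profile and its derivatives are additive
  under concatenation and invariant under time reversal. Continuity of \<open>f\<close> is assumed in the form in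
  which it is used, along continuous curves.
\<close>

context
  fixes f :: "real \<Rightarrow> real \<Rightarrow> real \<Rightarrow> real"
  assumes joint: "\<And>p q r :: real \<Rightarrow> real. continuous_on UNIV p \<Longrightarrow> continuous_on UNIV q \<Longrightarrow>
    continuous_on UNIV r \<Longrightarrow> continuous_on UNIV (\<lambda>t. f (p t) (q t) (r t))"
begin

lemma profile_continuous:
  assumes "profile x y T V V1 V2"
  shows "continuous_on S V" "continuous_on S V1" "continuous_on S V2"
    "continuous_on S (\<lambda>t. f (V t) (V1 t) (V2 t))"
proof -
  have "continuous_on UNIV V" "continuous_on UNIV V1" "continuous_on UNIV V2"
    using assms DERIV_isCont unfolding profile_def
    by (blast intro: continuous_at_imp_continuous_on)+
  moreover from this have "continuous_on UNIV (\<lambda>t. f (V t) (V1 t) (V2 t))" by (rule joint)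
  ultimately show "continuous_on S V" "continuous_on S V1" "continuous_on S V2"
    "continuous_on S (\<lambda>t. f (V t) (V1 t) (V2 t))"
    using continuous_on_subset by blast+
qed

lemma integral_profile_append:
  assumes V: "profile x y T V V1 V2" and U: "profile y z T' U U1 U2"
  shows "integral {0..T + T'} (\<lambda>t. f (V t + U (t - T) - y) (V1 t + U1 (t - T)) (V2 t + U2 (t - T))) =
    integral {0..T} (\<lambda>t. f (V t) (V1 t) (V2 t)) + integral {0..T'} (\<lambda>t. f (U t) (U1 t) (U2 t))"
proof -
  let ?g = "\<lambda>t. f (V t + U (t - T) - y) (V1 t + U1 (t - T)) (V2 t + U2 (t - T))"
  have T: "0 \<le> T" "0 \<le> T'" using V U by (auto simp: profile_def)
  have sh: "continuous_on UNIV (\<lambda>t. u (t - T))" if "continuous_on UNIV u" for u :: "real \<Rightarrow> real"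
    by (rule continuous_on_compose2[OF that]) (auto intro!: continuous_intros)
  have "continuous_on UNIV ?g"
    by (intro joint continuous_intros profile_continuous[OF V] sh profile_continuous[OF U])
  then have int: "?g integrable_on {0..T + T'}"
    by (intro integrable_continuous_interval) (rule continuous_on_subset, auto)
  have "integral {0..T + T'} ?g = integral {0..T} ?g + integral {T..T + T'} ?g"
    using T int by (intro Henstock_Kurzweil_Integration.integral_combine[symmetric]) auto
  also have "integral {0..T} ?g = integral {0..T} (\<lambda>t. f (V t) (V1 t) (V2 t))"
    using U by (intro integral_cong) (simp add: profile_def)
  also have "integral {T..T + T'} ?g = integral {T..T + T'} ((\<lambda>t. f (U t) (U1 t) (U2 t)) \<circ> (\<lambda>t. t + - T))"
    using V by (intro integral_cong) (simp add: profile_def)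
  also have "\<dots> = integral {T + - T..T + T' + - T} (\<lambda>t. f (U t) (U1 t) (U2 t))"
    by (rule integral_shift[OF profile_continuous(4)[OF U]])
  finally show ?thesis by simp
qed

lemma integral_profile_reverse:
  assumes V: "profile x y T V V1 V2"
  shows "integral {0..T} (\<lambda>t. f (V (T - t)) (V1 (T - t)) (V2 (T - t))) =
    integral {0..T} (\<lambda>t. f (V t) (V1 t) (V2 t))"
proof -
  let ?g = "\<lambda>t. f (V t) (V1 t) (V2 t)"
  have "integral {0..T} (\<lambda>t. ?g (T - t)) = integral {0..T} ((\<lambda>s. ?g (- s)) \<circ> (\<lambda>t. t + - T))"
    by (simp add: o_def)
  also have "\<dots> = integral {0 + - T..T + - T} (\<lambda>s. ?g (- s))"
    by (intro integral_shift continuous_on_compose2[OF profile_continuous(4)[OF V, of UNIV]])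
      (auto intro: continuous_intros)
  also have "\<dots> = integral {- T..- 0} (\<lambda>s. ?g (- s))" by simp
  also have "\<dots> = integral {0..T} ?g" by (rule Henstock_Kurzweil_Integration.integral_reflect_real)
  finally show ?thesis .
qed

end

lemma profile_append:
  assumes "profile x y T V V1 V2" and "profile y z T' U U1 U2"
  shows "profile x z (T + T') (\<lambda>t. V t + U (t - T) - y) (\<lambda>t. V1 t + U1 (t - T)) (\<lambda>t. V2 t + U2 (t - T))"
proof -
  have sh: "((\<lambda>t. p (t - T)) has_real_derivative p' (t - T)) (at t)"
    if "\<forall>t. (p has_real_derivative p' t) (at t)" for p p' :: "real \<Rightarrow> real" and t
    using DERIV_shift[of p "p' (t - T)" t "- T"] that by simp
  have "continuous_on UNIV (\<lambda>t. U2 (t - T))"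
    by (rule continuous_on_compose2[of UNIV U2]) (use assms in \<open>auto simp: profile_def intro!: continuous_intros\<close>)
  then show ?thesis
    using assms unfolding profile_def
    by (auto intro!: continuous_intros derivative_eq_intros sh)
qed

lemma profile_reverse:
  assumes "profile x y T V V1 V2"
  shows "profile y x T (\<lambda>t. V (T - t)) (\<lambda>t. - V1 (T - t)) (\<lambda>t. V2 (T - t))"
proof -
  have rv: "((\<lambda>t. p (T - t)) has_real_derivative - p' (T - t)) (at t)"
    if "\<forall>t. (p has_real_derivative p' t) (at t)" for p p' :: "real \<Rightarrow> real" and t
  proof -
    have "((\<lambda>t. T - t) has_real_derivative - 1) (at t)" by (auto intro!: derivative_eq_intros)
    from DERIV_chain2[OF that[rule_format] this] show ?thesis by simp
  qed
  have "continuous_on UNIV (\<lambda>t. V2 (T - t))"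
    by (rule continuous_on_compose2[of UNIV V2]) (use assms in \<open>auto simp: profile_def intro!: continuous_intros\<close>)
  moreover have "((\<lambda>t. - V1 (T - t)) has_real_derivative V2 (T - t)) (at t)" for t
    using DERIV_minus[OF rv[of V1 V2 t]] assms by (simp add: profile_def)
  ultimately show ?thesis
    using assms rv[of V V1] unfolding profile_def by auto
qed

context double_well
begin

text \<open>
  There is a profile from \<open>x\<close> to \<open>y\<close> of duration \<open>T\<close> with squared speed at most \<open>B\<close>, energy \<open>E\<close>, and cost \<open>D\<close>
  for the curvature \<open>\<kappa>\<close>.
\<close>

definition has_path :: "real \<Rightarrow> real \<Rightarrow> real \<Rightarrow> real \<Rightarrow> real \<Rightarrow> real \<Rightarrow> real \<Rightarrow> real \<Rightarrow> bool" where
  "has_path \<epsilon> \<kappa> B x y T E D \<longleftrightarrow> (\<exists>V V1 V2. profile x y T V V1 V2 \<and> (\<forall>t. (V1 t)\<^sup>2 \<le> B) \<and>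
     integral {0..T} (profile_density W V V1) = E \<and>
     integral {0..T} (\<lambda>t. (profile_defect W \<epsilon> \<kappa> V V1 V2 t)\<^sup>2 * profile_density W V V1 t) = D)"

lemma joint_density:
  fixes p q r :: "real \<Rightarrow> real"
  assumes "continuous_on UNIV p" "continuous_on UNIV q" "continuous_on UNIV r"
  shows "continuous_on UNIV (\<lambda>t. (q t)\<^sup>2 + W (p t))"
    and "continuous_on UNIV (\<lambda>t. ((2 * r t - deriv W (p t)) / \<epsilon> + 2 * \<kappa> * q t)\<^sup>2 * ((q t)\<^sup>2 + W (p t)))"
proof -
  have *: "continuous_on UNIV (\<lambda>t. W (p t))" "continuous_on UNIV (\<lambda>t. deriv W (p t))"
    using continuous_on_compose2[OF continuous_on_W[of UNIV] assms(1)]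
      continuous_on_compose2[OF continuous_on_W'[of UNIV] assms(1)] by simp_all
  show "continuous_on UNIV (\<lambda>t. (q t)\<^sup>2 + W (p t))"
    by (intro continuous_intros assms *)
  show "continuous_on UNIV (\<lambda>t. ((2 * r t - deriv W (p t)) / \<epsilon> + 2 * \<kappa> * q t)\<^sup>2 * ((q t)\<^sup>2 + W (p t)))"
    unfolding divide_inverse by (intro continuous_intros assms *)
qed

lemma has_path_append:
  assumes "has_path \<epsilon> \<kappa> B x y T E D" "has_path \<epsilon> \<kappa> B y z T' E' D'"
  shows "has_path \<epsilon> \<kappa> B x z (T + T') (E + E') (D + D')"
proof -
  obtain V V1 V2 where V: "profile x y T V V1 V2" "\<forall>t. (V1 t)\<^sup>2 \<le> B"
    "integral {0..T} (profile_density W V V1) = E"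
    "integral {0..T} (\<lambda>t. (profile_defect W \<epsilon> \<kappa> V V1 V2 t)\<^sup>2 * profile_density W V V1 t) = D"
    using assms(1) unfolding has_path_def by (elim exE conjE)
  obtain U U1 U2 where U: "profile y z T' U U1 U2" "\<forall>t. (U1 t)\<^sup>2 \<le> B"
    "integral {0..T'} (profile_density W U U1) = E'"
    "integral {0..T'} (\<lambda>t. (profile_defect W \<epsilon> \<kappa> U U1 U2 t)\<^sup>2 * profile_density W U U1 t) = D'"
    using assms(2) unfolding has_path_def by (elim exE conjE)
  have "V1 t + U1 (t - T) = V1 t \<or> V1 t + U1 (t - T) = U1 (t - T)" for t
    using V(1) U(1) unfolding profile_def by (cases "t \<le> T") auto
  then have bd: "(V1 t + U1 (t - T))\<^sup>2 \<le> B" for t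
    using V(2) U(2) by metis
  have "integral {0..T + T'} (profile_density W (\<lambda>t. V t + U (t - T) - y) (\<lambda>t. V1 t + U1 (t - T))) = E + E'"
    unfolding V(3)[symmetric] U(3)[symmetric] profile_density_def[abs_def]
    by (rule integral_profile_append[where f = "\<lambda>p q r. q\<^sup>2 + W p", OF joint_density(1) V(1) U(1)])
  moreover have "integral {0..T + T'} (\<lambda>t.
      (profile_defect W \<epsilon> \<kappa> (\<lambda>t. V t + U (t - T) - y) (\<lambda>t. V1 t + U1 (t - T)) (\<lambda>t. V2 t + U2 (t - T)) t)\<^sup>2 *
      profile_density W (\<lambda>t. V t + U (t - T) - y) (\<lambda>t. V1 t + U1 (t - T)) t) = D + D'"
    unfolding V(4)[symmetric] U(4)[symmetric] profile_density_def[abs_def] profile_defect_def[abs_def]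
    by (rule integral_profile_append[where f = "\<lambda>p q r. ((2 * r - deriv W p) / \<epsilon> + 2 * \<kappa> * q)\<^sup>2 * (q\<^sup>2 + W p)",
        OF joint_density(2) V(1) U(1)])
  ultimately show ?thesis
    unfolding has_path_def using profile_append[OF V(1) U(1)] bd by (intro exI conjI allI)
qed

text \<open>
  Time reversal changes the sign of \<open>V'\<close>, which amounts to changing the sign of \<open>\<kappa>\<close>.
\<close>

lemma has_path_reverse:
  assumes "has_path \<epsilon> (- \<kappa>) B x y T E D"
  shows "has_path \<epsilon> \<kappa> B y x T E D"
proof -
  obtain V V1 V2 where V: "profile x y T V V1 V2" "\<forall>t. (V1 t)\<^sup>2 \<le> B"
    "integral {0..T} (profile_density W V V1) = E"
    "integral {0..T} (\<lambda>t. (profile_defect W \<epsilon> (- \<kappa>) V V1 V2 t)\<^sup>2 * profile_density W V V1 t) = D"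
    using assms(1) unfolding has_path_def by (elim exE conjE)
  have "integral {0..T} (profile_density W (\<lambda>t. V (T - t)) (\<lambda>t. - V1 (T - t))) = E"
    unfolding V(3)[symmetric] profile_density_def[abs_def] power2_minus
    by (rule integral_profile_reverse[where f = "\<lambda>p q r. q\<^sup>2 + W p", OF joint_density(1) V(1)])
  moreover have "integral {0..T} (\<lambda>t.
      (profile_defect W \<epsilon> \<kappa> (\<lambda>t. V (T - t)) (\<lambda>t. - V1 (T - t)) (\<lambda>t. V2 (T - t)) t)\<^sup>2 *
      profile_density W (\<lambda>t. V (T - t)) (\<lambda>t. - V1 (T - t)) t) = D"
    unfolding V(4)[symmetric] profile_density_def[abs_def] profile_defect_def[abs_def] power2_minus
      mult_minus_right mult_minus_left
    by (rule integral_profile_reverse[where f = "\<lambda>p q r. ((2 * r - deriv W p) / \<epsilon> + - (2 * \<kappa> * q))\<^sup>2 * (q\<^sup>2 + W p)",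
        OF joint_density(2)[where \<kappa> = "- \<kappa>", simplified mult_minus_right mult_minus_left] V(1)])
  moreover have "\<forall>t. (- V1 (T - t))\<^sup>2 \<le> B" using V(2) by simp
  ultimately show ?thesis
    unfolding has_path_def using profile_reverse[OF V(1)] by (intro exI conjI)
qed

lemma has_path_repeat:
  assumes "has_path \<epsilon> \<kappa> B x x T E D" "B \<ge> 0"
  shows "has_path \<epsilon> \<kappa> B x x (real n * T) (real n * E) (real n * D)"
proof (induction n)
  case 0
  show ?case
    unfolding has_path_def using assms(2)
    by (intro exI[of _ "\<lambda>_. x"] exI[of _ "\<lambda>_. 0"]) (auto simp: profile_def)
next
  case (Suc n)
  from has_path_append[OF this assms(1)] show ?case by (simp add: algebra_simps)
qed

end

section \<open>Radial functions and integration in polar coordinates\<close>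

text \<open>
  The surface area of the unit sphere in \<open>n\<close> dimensions, expressed through the volume of the unit ball.
\<close>

definition sphere_area :: "nat \<Rightarrow> real" where
  "sphere_area n = real n * unit_ball_vol (real n)"

lemma sphere_area_pos: "0 < n \<Longrightarrow> 0 < sphere_area n"
  by (simp add: sphere_area_def)

text \<open>
  Polar coordinates for radial functions: both sides agree on balls.
\<close>

lemma distr_norm_lborel:
  "distr lborel borel (norm :: 'a::euclidean_space \<Rightarrow> real) =
   density lborel (\<lambda>t. ennreal (sphere_area DIM('a) * t ^ (DIM('a) - 1)) * indicator {0..} t)"
  (is "?M = ?N")
proof (rule measure_eqI_generator_eq[where E = "range atMost" and \<Omega> = UNIV and A = "\<lambda>n. {..real n}"])
  let ?n = "DIM('a)"
  show "Int_stable (range atMost :: real set set)"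
    by (auto simp: Int_stable_def)
  show "sets ?M = sigma_sets UNIV (range atMost)" "sets ?N = sigma_sets UNIV (range atMost)"
    by (simp_all add: borel_eq_atMost)
  show "(\<Union>i. {..real i}) = UNIV"
    using real_arch_simple by (auto simp: set_eq_iff)
  have M: "emeasure ?M {..r} = ennreal (unit_ball_vol (real ?n) * r ^ ?n)" if "r \<ge> 0" for r :: real
  proof -
    have "norm -` {..r} \<inter> space lborel = cball (0 :: 'a) r" by (auto simp: dist_norm)
    then show ?thesis by (simp add: emeasure_distr emeasure_cball[OF that])
  qed
  then show "emeasure ?M {..real i} \<noteq> \<infinity>" for i by simp
  have N: "emeasure ?N {..r} = ennreal (unit_ball_vol (real ?n) * r ^ ?n)" if r: "r \<ge> 0" for r :: real
  proof -
    have "emeasure ?N {..r} =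
        (\<integral>\<^sup>+t. ennreal (sphere_area ?n * t ^ (?n - 1)) * indicator {0..r} t \<partial>lborel)"
      by (subst emeasure_density) (auto intro!: nn_integral_cong split: split_indicator)
    also have "\<dots> = ennreal (unit_ball_vol (real ?n) * r ^ ?n - unit_ball_vol (real ?n) * 0 ^ ?n)"
    proof (rule nn_integral_FTC_Icc[OF _ _ _ r])
      fix t :: real assume t: "t \<in> {0..r}"
      show "((\<lambda>t. unit_ball_vol (real ?n) * t ^ ?n) has_real_derivative sphere_area ?n * t ^ (?n - 1)) (at t)"
        by (auto intro!: derivative_eq_intros simp: sphere_area_def)
      show "0 \<le> sphere_area ?n * t ^ (?n - 1)" using t by (simp add: sphere_area_def)
    qed auto
    also have "unit_ball_vol (real ?n) * r ^ ?n - unit_ball_vol (real ?n) * 0 ^ ?n =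
        unit_ball_vol (real ?n) * r ^ ?n"
      by (simp only: zero_power[OF DIM_positive] mult_zero_right diff_zero)
    finally show ?thesis .
  qed
  show "emeasure ?M X = emeasure ?N X" if mem: "X \<in> range atMost" for X
  proof -
    obtain r where X: "X = {..r}" using mem by auto
    show ?thesis
    proof (cases "r \<ge> 0")
      case True
      then show ?thesis unfolding X by (simp only: M N)
    next
      case False
      have "\<not> norm x \<le> r" for x :: 'a using False norm_ge_zero[of x] by linarith
      then have "norm -` {..r} \<inter> space lborel = ({} :: 'a set)" by auto
      moreover have "emeasure ?N {..r} = (\<integral>\<^sup>+t. 0 \<partial>(lborel :: real measure))"
        by (subst emeasure_density, simp, simp, rule nn_integral_cong)
          (use False in \<open>auto split: split_indicator\<close>)
      ultimately show ?thesis unfolding X by (simp add: emeasure_distr)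
    qed
  qed
qed auto

lemma nn_integral_radial_shell:
  fixes f :: "real \<Rightarrow> real"
  assumes cont: "continuous_on UNIV f" and nonneg: "\<And>t. 0 \<le> f t"
    and r: "0 \<le> r0" "r0 \<le> r1" and supp: "\<And>t. t \<notin> {r0..r1} \<Longrightarrow> f t = 0"
  shows "ennreal (sphere_area DIM('a) * r0 ^ (DIM('a) - 1) * integral {r0..r1} f)
      \<le> (\<integral>\<^sup>+x. ennreal (f (norm (x :: 'a::euclidean_space))) \<partial>lborel)"
    and "(\<integral>\<^sup>+x. ennreal (f (norm (x :: 'a))) \<partial>lborel)
      \<le> ennreal (sphere_area DIM('a) * r1 ^ (DIM('a) - 1) * integral {r0..r1} f)"
proof -
  let ?n = "DIM('a)"
  let ?w = "sphere_area ?n"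
  have w: "?w \<ge> 0" by (simp add: sphere_area_def)
  have [measurable]: "f \<in> borel_measurable borel" using cont by (rule borel_measurable_continuous_onI)
  have eq: "(\<integral>\<^sup>+x. ennreal (f (norm (x :: 'a))) \<partial>lborel) =
      (\<integral>\<^sup>+t. ennreal (?w * t ^ (?n - 1)) * indicator {0..} t * ennreal (f t) \<partial>lborel)"
  proof -
    have "(\<integral>\<^sup>+x. ennreal (f (norm (x :: 'a))) \<partial>lborel) =
        (\<integral>\<^sup>+t. ennreal (f t) \<partial>distr lborel borel (norm :: 'a \<Rightarrow> real))"
      by (subst nn_integral_distr) auto
    also have "\<dots> = (\<integral>\<^sup>+t. ennreal (?w * t ^ (?n - 1)) * indicator {0..} t * ennreal (f t) \<partial>lborel)"
      unfolding distr_norm_lborel by (subst nn_integral_density) auto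
    finally show ?thesis .
  qed
  have int: "f integrable_on {r0..r1}"
    by (rule integrable_continuous_interval[OF continuous_on_subset[OF cont]]) simp
  have c: "(\<integral>\<^sup>+t. ennreal (c * f t) * indicator {r0..r1} t \<partial>lborel) = ennreal (c * integral {r0..r1} f)"
    if "c \<ge> 0" for c
    using that nonneg int
    by (intro nn_integral_has_integral_lebesgue' has_integral_mult_right integrable_integral) auto
  have wr: "?w * r0 ^ (?n - 1) \<ge> 0" "?w * r1 ^ (?n - 1) \<ge> 0" using w r by auto
  show "ennreal (?w * r0 ^ (?n - 1) * integral {r0..r1} f)
      \<le> (\<integral>\<^sup>+x. ennreal (f (norm (x :: 'a))) \<partial>lborel)"
    unfolding eq c[OF wr(1), symmetric]
  proof (rule nn_integral_mono)
    fix t show "ennreal (?w * r0 ^ (?n - 1) * f t) * indicator {r0..r1} t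
      \<le> ennreal (?w * t ^ (?n - 1)) * indicator {0..} t * ennreal (f t)"
    proof (cases "t \<in> {r0..r1}")
      case True
      then have "?w * r0 ^ (?n - 1) * f t \<le> ?w * t ^ (?n - 1) * f t"
        using r w nonneg by (intro mult_right_mono mult_left_mono power_mono) auto
      then show ?thesis
        using True r w nonneg by (simp add: ennreal_leI flip: ennreal_mult)
    qed auto
  qed
  show "(\<integral>\<^sup>+x. ennreal (f (norm (x :: 'a))) \<partial>lborel)
      \<le> ennreal (?w * r1 ^ (?n - 1) * integral {r0..r1} f)"
    unfolding eq c[OF wr(2), symmetric]
  proof (rule nn_integral_mono)
    fix t show "ennreal (?w * t ^ (?n - 1)) * indicator {0..} t * ennreal (f t) \<le>
      ennreal (?w * r1 ^ (?n - 1) * f t) * indicator {r0..r1} t"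
    proof (cases "t \<in> {r0..r1}")
      case True
      then have "?w * t ^ (?n - 1) * f t \<le> ?w * r1 ^ (?n - 1) * f t"
        using r w nonneg by (intro mult_right_mono mult_left_mono power_mono) auto
      then show ?thesis
        using True r w nonneg by (simp add: ennreal_leI flip: ennreal_mult)
    qed (use supp in auto)
  qed
qed

lemma DERIV_square_norm_line:
  "((\<lambda>t. (x + t *\<^sub>R v) \<bullet> (x + t *\<^sub>R v)) has_real_derivative 2 * (x \<bullet> v)) (at 0)"
proof -
  have "((\<lambda>t. (x + t *\<^sub>R v) \<bullet> (x + t *\<^sub>R v)) has_derivative (\<lambda>t. x \<bullet> (t *\<^sub>R v) + (t *\<^sub>R v) \<bullet> x)) (at 0)"
    by (auto intro!: derivative_eq_intros)
  moreover have "(\<lambda>t. x \<bullet> (t *\<^sub>R v) + (t *\<^sub>R v) \<bullet> x) = (*) (2 * (x \<bullet> v))"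
  proof
    fix t show "x \<bullet> (t *\<^sub>R v) + (t *\<^sub>R v) \<bullet> x = 2 * (x \<bullet> v) * t"
      by (simp add: inner_commute[of v x])
  qed
  ultimately show ?thesis by (simp add: has_field_derivative_def)
qed

text \<open>
  Radial functions are treated as functions of \<open>x \<bullet> x\<close>, which is smooth also at the origin.
\<close>

context
  fixes f f1 f2 :: "real \<Rightarrow> real"
  assumes f1: "\<And>s. (f has_real_derivative f1 s) (at s)"
    and f2: "\<And>s. (f1 has_real_derivative f2 s) (at s)"
    and contf2: "continuous_on UNIV f2"
begin

lemma C2_square_radial: "C2 (\<lambda>x::'a::euclidean_space. f (x \<bullet> x))"
proof -
  let ?I = "blinfun_inner_right :: 'a \<Rightarrow> 'a \<Rightarrow>\<^sub>L real"
  define L where "L = Blinfun ?I"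
  have L: "blinfun_apply L = ?I"
    unfolding L_def by (rule bounded_linear_Blinfun_apply[OF bounded_linear_blinfun_inner_right])
  define D where "D x = (2 * f1 (x \<bullet> x)) *\<^sub>R ?I x" for x
  define D2 where "D2 x = (2 * f1 (x \<bullet> x)) *\<^sub>R L
      + (4 * f2 (x \<bullet> x)) *\<^sub>R (blinfun_scaleR_left (?I x) o\<^sub>L ?I x)" for x
  have sq: "((\<lambda>x. x \<bullet> x) has_derivative (\<lambda>y. 2 * (x \<bullet> y))) (at x)" for x :: 'a
    by (auto intro!: derivative_eq_intros simp: inner_commute)
  have ch: "((\<lambda>x. p (x \<bullet> x)) has_derivative (\<lambda>y. p' (x \<bullet> x) * (2 * (x \<bullet> y)))) (at x)"
    if "\<And>s. (p has_real_derivative p' s) (at s)" for p p' :: "real \<Rightarrow> real" and x :: 'a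
    using has_derivative_compose[OF sq[of x], of p "(*) (p' (x \<bullet> x))"] that
    by (simp add: has_field_derivative_def)
  have 1: "((\<lambda>x. f (x \<bullet> x)) has_derivative blinfun_apply (D x)) (at x)" for x
  proof -
    have "blinfun_apply (D x) = (\<lambda>y. f1 (x \<bullet> x) * (2 * (x \<bullet> y)))"
      by (auto simp: D_def fun_eq_iff blinfun.scaleR_left)
    then show ?thesis using ch[OF f1, of x] by simp
  qed
  have 2: "(D has_derivative blinfun_apply (D2 x)) (at x)" for x
  proof -
    have "(?I has_derivative ?I) (at x)"
      by (rule bounded_linear_imp_has_derivative[OF bounded_linear_blinfun_inner_right])
    from has_derivative_scaleR[OF has_derivative_mult_right[OF ch[OF f2, of x], of 2] this]
    have "(D has_derivative (\<lambda>y. (2 * f1 (x \<bullet> x)) *\<^sub>R ?I y +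
        (2 * (f2 (x \<bullet> x) * (2 * (x \<bullet> y)))) *\<^sub>R ?I x)) (at x)"
      unfolding D_def .
    moreover have "(\<lambda>y. (2 * f1 (x \<bullet> x)) *\<^sub>R ?I y + (2 * (f2 (x \<bullet> x) * (2 * (x \<bullet> y)))) *\<^sub>R ?I x) =
        blinfun_apply (D2 x)"
      by (auto simp: D2_def fun_eq_iff blinfun.add_left blinfun.scaleR_left L)
    ultimately show ?thesis by simp
  qed
  have 3: "continuous_on UNIV D2"
  proof -
    have contf1: "continuous_on UNIV f1"
      using f2 DERIV_isCont by (blast intro: continuous_at_imp_continuous_on)
    have sqc: "continuous_on UNIV (\<lambda>x::'a. x \<bullet> x)" by (intro continuous_intros)
    have "continuous_on UNIV (\<lambda>x::'a. f1 (x \<bullet> x))" "continuous_on UNIV (\<lambda>x::'a. f2 (x \<bullet> x))"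
      using continuous_on_compose2[OF contf1 sqc] continuous_on_compose2[OF contf2 sqc] by simp_all
    moreover have "continuous_on UNIV ?I"
      by (rule linear_continuous_on[OF bounded_linear_blinfun_inner_right])
    moreover from this have "continuous_on UNIV (\<lambda>x. blinfun_scaleR_left (?I x))"
      by (rule bounded_linear.continuous_on[OF bounded_linear_blinfun_scaleR_left])
    ultimately show ?thesis
      unfolding D2_def
      by (intro continuous_intros bounded_bilinear.continuous_on[OF bounded_bilinear_blinfun_compose])
  qed
  show ?thesis unfolding C2_def using 1 2 3 by blast
qed

lemma dir_deriv_square_radial: "dir_deriv v (\<lambda>x. f (x \<bullet> x)) x = 2 * f1 (x \<bullet> x) * (x \<bullet> v)"
proof -
  have "((\<lambda>t. f ((x + t *\<^sub>R v) \<bullet> (x + t *\<^sub>R v))) has_real_derivative f1 (x \<bullet> x) * (2 * (x \<bullet> v))) (at 0)"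
    using DERIV_chain2[OF f1 DERIV_square_norm_line[of x v]] by simp
  from DERIV_imp_deriv[OF this] show ?thesis by (simp add: dir_deriv_def mult_ac)
qed

lemma grad_square_radial: "grad (\<lambda>x. f (x \<bullet> x)) x = (2 * f1 (x \<bullet> x)) *\<^sub>R x"
proof -
  have "grad (\<lambda>x. f (x \<bullet> x)) x = (2 * f1 (x \<bullet> x)) *\<^sub>R (\<Sum>b\<in>Basis. (x \<bullet> b) *\<^sub>R b)"
    unfolding grad_def dir_deriv_square_radial by (simp add: scaleR_sum_right mult_ac)
  then show ?thesis by (simp add: euclidean_representation)
qed

lemma laplacian_square_radial:
  "laplacian (\<lambda>x::'a::euclidean_space. f (x \<bullet> x)) x =
     4 * f2 (x \<bullet> x) * (x \<bullet> x) + 2 * real DIM('a) * f1 (x \<bullet> x)"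
proof -
  have "dir_deriv v (dir_deriv v (\<lambda>x. f (x \<bullet> x))) x =
      4 * f2 (x \<bullet> x) * (x \<bullet> v)\<^sup>2 + 2 * f1 (x \<bullet> x) * (v \<bullet> v)" for v :: 'a
  proof -
    have "((\<lambda>t. f1 ((x + t *\<^sub>R v) \<bullet> (x + t *\<^sub>R v))) has_real_derivative f2 (x \<bullet> x) * (2 * (x \<bullet> v))) (at 0)"
      using DERIV_chain2[OF f2 DERIV_square_norm_line[of x v]] by simp
    moreover have "((\<lambda>t. (x + t *\<^sub>R v) \<bullet> v) has_real_derivative v \<bullet> v) (at 0)"
      by (auto intro!: derivative_eq_intros simp: inner_add_left)
    ultimately have "((\<lambda>t. 2 * f1 ((x + t *\<^sub>R v) \<bullet> (x + t *\<^sub>R v)) * ((x + t *\<^sub>R v) \<bullet> v)) has_real_derivative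
        4 * f2 (x \<bullet> x) * (x \<bullet> v)\<^sup>2 + 2 * f1 (x \<bullet> x) * (v \<bullet> v)) (at 0)"
      by (auto intro!: derivative_eq_intros simp: power2_eq_square)
    from DERIV_imp_deriv[OF this] show ?thesis
      unfolding dir_deriv_def[of v "dir_deriv v (\<lambda>x. f (x \<bullet> x))"] dir_deriv_square_radial .
  qed
  then have "laplacian (\<lambda>x::'a. f (x \<bullet> x)) x =
      4 * f2 (x \<bullet> x) * (\<Sum>b\<in>Basis. (x \<bullet> b)\<^sup>2) + (\<Sum>b\<in>(Basis :: 'a set). 2 * f1 (x \<bullet> x) * (b \<bullet> b))"
    unfolding laplacian_def by (simp add: sum.distrib sum_distrib_left)
  also have "(\<Sum>b\<in>Basis. (x \<bullet> b)\<^sup>2) = x \<bullet> x"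
    by (subst euclidean_inner[of x x]) (simp add: power2_eq_square)
  also have "(\<Sum>b\<in>(Basis :: 'a set). 2 * f1 (x \<bullet> x) * (b \<bullet> b)) = 2 * real DIM('a) * f1 (x \<bullet> x)"
    by (simp add: inner_same_Basis)
  finally show ?thesis .
qed

end

section \<open>Radial layers\<close>

context double_well
begin

text \<open>
  The functionals on the radial function built from a profile that starts and ends at \<open>a\<close>. The function is
  constant outside the shell between the radii \<open>r0\<close> and \<open>r1\<close>, and \<open>\<delta>\<close> is the oscillation of the
  mean curvature \<open>(n - 1) / norm x\<close> within the shell.
\<close>

lemma radial_layer:
  fixes V V1 V2 :: "real \<Rightarrow> real" and \<epsilon> r0 T B :: real
  defines "u \<equiv> \<lambda>x::'a::euclidean_space. V ((norm x - r0) / \<epsilon>)"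
  defines "r1 \<equiv> r0 + \<epsilon> * T"
  defines "\<kappa> \<equiv> real (DIM('a) - 1) / r0"
  defines "\<delta> \<equiv> real (DIM('a) - 1) / r0 - real (DIM('a) - 1) / r1"
  defines "E \<equiv> integral {0..T} (profile_density W V V1)"
  defines "D \<equiv> integral {0..T} (\<lambda>t. (profile_defect W \<epsilon> \<kappa> V V1 V2 t)\<^sup>2 * profile_density W V V1 t)"
  assumes prof: "profile a a T V V1 V2" and B: "\<And>t. (V1 t)\<^sup>2 \<le> B" and \<epsilon>: "\<epsilon> > 0" and r0: "r0 > 0"
  shows "C2 u"
    and "continuous_on UNIV (energy_density W \<epsilon> u)"
    and "\<And>x. 0 \<le> energy_density W \<epsilon> u x"
    and "\<And>x. norm x > r1 \<Longrightarrow> energy_density W \<epsilon> u x = 0"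
    and "ennreal (sphere_area DIM('a) * r0 ^ (DIM('a) - 1) * E) \<le> E_fun W \<epsilon> u UNIV"
    and "E_fun W \<epsilon> u UNIV \<le> ennreal (sphere_area DIM('a) * r1 ^ (DIM('a) - 1) * E)"
    and "G_fun W \<epsilon> u UNIV \<le> ennreal (sphere_area DIM('a) * r1 ^ (DIM('a) - 1) * (2 * D + 8 * \<delta>\<^sup>2 * B * E))"
proof -
  have T: "0 \<le> T"
    and dV: "(V has_real_derivative V1 t) (at t)" and dV1: "(V1 has_real_derivative V2 t) (at t)"
    and contV2: "continuous_on UNIV V2"
    and left: "t \<le> 0 \<Longrightarrow> V t = a \<and> V1 t = 0 \<and> V2 t = 0"
    and right: "t \<ge> T \<Longrightarrow> V t = a \<and> V1 t = 0 \<and> V2 t = 0" for t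
    using prof unfolding profile_def by blast+
  have contV: "continuous_on UNIV V" and contV1: "continuous_on UNIV V1"
    using dV dV1 DERIV_isCont by (blast intro: continuous_at_imp_continuous_on)+
  have r1: "r0 \<le> r1" using T \<epsilon> by (simp add: r1_def)
  define \<tau> where "\<tau> s = (sqrt s - r0) / \<epsilon>" for s
  \<comment> \<open>\<open>u x = f (x \<bullet> x)\<close>. For \<open>s < r0\<^sup>2\<close> the stretched variable is negative, so \<open>f\<close> is constant
      there and the formulas for \<open>f1\<close> and \<open>f2\<close> give 0, also at \<open>s \<le> 0\<close>.\<close>
  define f where "f s = V (\<tau> s)" for s
  define f1 where "f1 s = V1 (\<tau> s) * inverse (2 * \<epsilon> * sqrt s)" for s
  define f2 where "f2 s = V2 (\<tau> s) / (4 * \<epsilon>\<^sup>2 * s) - V1 (\<tau> s) / (4 * \<epsilon> * s * sqrt s)" for s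
  have low: "\<tau> s \<le> 0" if "s < r0\<^sup>2" for s
  proof -
    have "sqrt s < sqrt (r0\<^sup>2)" using that by (rule real_sqrt_less_mono)
    then show ?thesis using r0 \<epsilon> by (simp add: \<tau>_def divide_le_0_iff)
  qed
  have d\<tau>: "(\<tau> has_real_derivative inverse (2 * \<epsilon> * sqrt s)) (at s)" if "s > 0" for s
    unfolding \<tau>_def using that \<epsilon> by (auto intro!: derivative_eq_intros simp: field_simps)
  have near: "(p has_real_derivative 0) (at s)" if "s < r0\<^sup>2" "\<And>s. s < r0\<^sup>2 \<Longrightarrow> p s = c"
    for p :: "real \<Rightarrow> real" and c s
  proof -
    have "((\<lambda>_. c) has_real_derivative 0) (at s)" by simp
    then show ?thesis
      by (rule has_field_derivative_transform_within_open[where S = "{..<r0\<^sup>2}"]) (use that in auto)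
  qed
  have cover: "s > 0 \<or> s < r0\<^sup>2" for s using r0 by (cases "s > 0") (auto simp: not_less intro: le_less_trans)
  have df: "(f has_real_derivative f1 s) (at s)" for s
  proof (cases "s < r0\<^sup>2")
    case True
    then have "(f has_real_derivative 0) (at s)"
      by (rule near[where c = a]) (use low left in \<open>auto simp: f_def\<close>)
    then show ?thesis using low[OF True] left[of "\<tau> s"] by (simp add: f1_def)
  next
    case False
    then have "s > 0" using cover by blast
    from DERIV_chain2[OF dV d\<tau>[OF this]] show ?thesis unfolding f_def f1_def .
  qed
  have df1: "(f1 has_real_derivative f2 s) (at s)" for s
  proof (cases "s < r0\<^sup>2")
    case True
    then have "(f1 has_real_derivative 0) (at s)"
      by (rule near[where c = 0]) (use low left in \<open>auto simp: f1_def\<close>)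
    then show ?thesis using low[OF True] left[of "\<tau> s"] by (simp add: f2_def)
  next
    case False
    then have s: "s > 0" using cover by blast
    have inv: "((\<lambda>s. inverse (2 * \<epsilon> * sqrt s)) has_real_derivative - (1 / (4 * \<epsilon> * s * sqrt s))) (at s)"
      using s \<epsilon> by (auto intro!: derivative_eq_intros simp: field_simps power2_eq_square)
    have "(f1 has_real_derivative V2 (\<tau> s) * inverse (2 * \<epsilon> * sqrt s) * inverse (2 * \<epsilon> * sqrt s)
        + - (1 / (4 * \<epsilon> * s * sqrt s)) * V1 (\<tau> s)) (at s)"
      unfolding f1_def by (rule DERIV_mult[OF DERIV_chain2[OF dV1 d\<tau>[OF s]] inv])
    moreover have "inverse (2 * \<epsilon> * sqrt s) * inverse (2 * \<epsilon> * sqrt s) = 1 / (4 * \<epsilon>\<^sup>2 * s)"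
      using s by (simp add: field_simps power2_eq_square)
    moreover have "x * k * k + - (1 / c) * y = x * (k * k) - y / c" for x y k c :: real by simp
    ultimately show ?thesis by (simp only: f2_def) simp
  qed
  have contf2: "continuous_on UNIV f2"
  proof -
    have c\<tau>: "continuous_on S \<tau>" for S unfolding \<tau>_def using \<epsilon> by (intro continuous_intros) auto
    have "continuous_on {0<..} f2"
      unfolding f2_def using \<epsilon>
      by (intro continuous_intros continuous_on_compose2[OF contV2 c\<tau>] continuous_on_compose2[OF contV1 c\<tau>]) auto
    moreover have "f2 s = 0" if "s < r0\<^sup>2" for s
      using low[OF that] left[of "\<tau> s"] by (simp add: f2_def)
    then have "continuous_on {..<r0\<^sup>2} f2"
      by (subst continuous_on_cong[OF refl, of _ _ "\<lambda>_. 0"]) auto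
    ultimately have "continuous_on ({0<..} \<union> {..<r0\<^sup>2}) f2"
      by (intro continuous_on_open_Un) auto
    moreover have "{0<..} \<union> {..<r0\<^sup>2} = UNIV" using cover by auto
    ultimately show ?thesis by simp
  qed
  have u: "u = (\<lambda>x. f (x \<bullet> x))"
    unfolding u_def f_def \<tau>_def norm_eq_sqrt_inner ..
  show "C2 u" unfolding u by (rule C2_square_radial[OF df df1 contf2])
  define t where "t \<rho> = (\<rho> - r0) / \<epsilon>" for \<rho>
  have contt: "continuous_on S t" for S unfolding t_def using \<epsilon> by (intro continuous_intros) auto
  have \<tau>_norm: "\<tau> (x \<bullet> x) = t (norm x)" for x :: 'a
    unfolding \<tau>_def t_def norm_eq_sqrt_inner ..
  have f1_norm: "f1 (x \<bullet> x) = V1 (t (norm x)) / (2 * \<epsilon> * norm x)" for x :: 'a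
    unfolding f1_def \<tau>_norm unfolding norm_eq_sqrt_inner[symmetric] divide_inverse ..
  have f2_norm: "f2 (x \<bullet> x) = V2 (t (norm x)) / (4 * \<epsilon>\<^sup>2 * (norm x)\<^sup>2)
      - V1 (t (norm x)) / (4 * \<epsilon> * (norm x)\<^sup>2 * norm x)" for x :: 'a
    unfolding f2_def \<tau>_norm unfolding norm_eq_sqrt_inner[symmetric] power2_norm_eq_inner ..
  have zero: "V1 (t 0) = 0" "V2 (t 0) = 0"
    using left[of "t 0"] r0 \<epsilon> by (simp_all add: t_def)
  define e where "e = profile_density W V V1"
  have ed: "energy_density W \<epsilon> u x = e (t (norm x)) / \<epsilon>" for x
  proof -
    have "norm (grad u x) = 2 * \<bar>f1 (x \<bullet> x)\<bar> * norm x"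
      unfolding u grad_square_radial[OF df df1 contf2] by (simp add: abs_mult)
    then have "\<epsilon> * (norm (grad u x))\<^sup>2 = \<epsilon> * (2 * f1 (x \<bullet> x) * norm x)\<^sup>2"
      by (simp add: power_mult_distrib)
    also have "\<dots> = (V1 (t (norm x)))\<^sup>2 / \<epsilon>"
    proof (cases "x = 0")
      case True
      then show ?thesis using zero by simp
    next
      case False
      then show ?thesis using \<epsilon> by (simp add: f1_norm power2_eq_square field_simps)
    qed
    finally show ?thesis
      unfolding energy_density_def
      by (simp add: e_def profile_density_def u_def t_def add_divide_distrib)
  qed
  have e0: "0 \<le> e s" for s using W_nonneg by (simp add: e_def profile_density_def)
  have conte: "continuous_on UNIV e"
    unfolding e_def profile_density_def
    by (intro continuous_intros contV1 continuous_on_compose2[OF continuous_on_W contV]) auto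
  have e_out: "e (t \<rho>) = 0" if "\<rho> \<notin> {r0..r1}" for \<rho>
  proof -
    have "t \<rho> \<le> 0 \<or> t \<rho> \<ge> T"
      using that \<epsilon> by (auto simp: t_def r1_def field_simps divide_le_0_iff)
    then show ?thesis using left[of "t \<rho>"] right[of "t \<rho>"] wells by (auto simp: e_def profile_density_def)
  qed
  show "continuous_on UNIV (energy_density W \<epsilon> u)"
    unfolding ed[abs_def] using \<epsilon>
    by (intro continuous_intros continuous_on_compose2[OF conte] continuous_on_compose2[OF contt]) auto
  show "0 \<le> energy_density W \<epsilon> u x" for x using ed e0 \<epsilon> by simp
  show "energy_density W \<epsilon> u x = 0" if "norm x > r1" for x using ed e_out that by simp
  have resc: "integral {r0..r1} (\<lambda>\<rho>. p (t \<rho>) / \<epsilon>) = integral {0..T} p"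
    and contp: "continuous_on UNIV (\<lambda>\<rho>. p (t \<rho>) / \<epsilon>)"
    if p: "continuous_on UNIV p" for p :: "real \<Rightarrow> real"
  proof -
    have "(p has_integral integral {0..T} p) (cbox 0 T)"
      using integrable_integral[OF integrable_continuous_interval[OF continuous_on_subset[OF p]], of 0 T] by simp
    from has_integral_affinity'[OF this, of "1 / \<epsilon>" "- r0 / \<epsilon>"] \<epsilon>
    have "((\<lambda>\<rho>. p ((1 / \<epsilon>) *\<^sub>R \<rho> + - r0 / \<epsilon>)) has_integral integral {0..T} p /\<^sub>R (1 / \<epsilon>) ^ 1)
        (cbox ((0 - - r0 / \<epsilon>) /\<^sub>R (1 / \<epsilon>)) ((T - - r0 / \<epsilon>) /\<^sub>R (1 / \<epsilon>)))"
      by simp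
    moreover have "(1 / \<epsilon>) *\<^sub>R \<rho> + - r0 / \<epsilon> = t \<rho>" for \<rho>
      by (simp add: t_def diff_divide_distrib)
    moreover have "(0 - - r0 / \<epsilon>) /\<^sub>R (1 / \<epsilon>) = r0" "(T - - r0 / \<epsilon>) /\<^sub>R (1 / \<epsilon>) = r1"
      using \<epsilon> by (simp_all add: r1_def field_simps)
    moreover have "integral {0..T} p /\<^sub>R (1 / \<epsilon>) ^ 1 = \<epsilon> * integral {0..T} p" using \<epsilon> by simp
    ultimately have "((\<lambda>\<rho>. p (t \<rho>)) has_integral \<epsilon> * integral {0..T} p) {r0..r1}"
      by (simp only: box_real)
    from has_integral_divide[OF this, of \<epsilon>] \<epsilon>
    show "integral {r0..r1} (\<lambda>\<rho>. p (t \<rho>) / \<epsilon>) = integral {0..T} p"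
      by (intro integral_unique) simp
    show "continuous_on UNIV (\<lambda>\<rho>. p (t \<rho>) / \<epsilon>)"
      using \<epsilon> by (intro continuous_intros continuous_on_compose2[OF p contt]) auto
  qed
  have Efun: "E_fun W \<epsilon> u UNIV = (\<integral>\<^sup>+x. ennreal (e (t (norm (x :: 'a))) / \<epsilon>) \<partial>lborel)"
    unfolding E_fun_def ed by simp
  have Eint: "integral {r0..r1} (\<lambda>\<rho>. e (t \<rho>) / \<epsilon>) = E"
    unfolding resc[OF conte] by (simp add: E_def e_def)
  note shell = nn_integral_radial_shell[where 'a = 'a, OF contp _ less_imp_le[OF r0] r1]
  show "ennreal (sphere_area DIM('a) * r0 ^ (DIM('a) - 1) * E) \<le> E_fun W \<epsilon> u UNIV"
    unfolding Efun Eint[symmetric]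
    by (rule shell(1)[OF conte]) (use e0 e_out \<epsilon> in auto)
  show "E_fun W \<epsilon> u UNIV \<le> ennreal (sphere_area DIM('a) * r1 ^ (DIM('a) - 1) * E)"
    unfolding Efun Eint[symmetric]
    by (rule shell(2)[OF conte]) (use e0 e_out \<epsilon> in auto)
  define A where "A = profile_defect W \<epsilon> \<kappa> V V1 V2"
  have contA: "continuous_on UNIV A"
    unfolding A_def profile_defect_def using \<epsilon>
    by (intro continuous_intros contV1 contV2 continuous_on_compose2[OF continuous_on_W' contV]) auto
  define p where "p s = (2 * (A s)\<^sup>2 + 8 * \<delta>\<^sup>2 * B) * e s" for s
  have contp': "continuous_on UNIV p" unfolding p_def by (intro continuous_intros contA conte)
  have B0: "0 \<le> B" using B[of 0] zero_le_power2 order_trans by blast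
  have p0: "0 \<le> p s" for s unfolding p_def using B0 e0 by (intro mult_nonneg_nonneg add_nonneg_nonneg) auto
  have Gint: "integral {r0..r1} (\<lambda>\<rho>. p (t \<rho>) / \<epsilon>) = 2 * D + 8 * \<delta>\<^sup>2 * B * E"
  proof -
    have "integral {0..T} p = integral {0..T} (\<lambda>s. 2 * ((A s)\<^sup>2 * e s) + 8 * \<delta>\<^sup>2 * B * e s)"
      by (intro Henstock_Kurzweil_Integration.integral_cong) (simp add: p_def algebra_simps)
    also have "\<dots> = 2 * integral {0..T} (\<lambda>s. (A s)\<^sup>2 * e s) + 8 * \<delta>\<^sup>2 * B * integral {0..T} e"
      by (subst integral_add)
        (simp_all only: integral_mult_right,
          auto intro!: integrable_continuous_interval continuous_intros
            continuous_on_subset[OF contA] continuous_on_subset[OF conte])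
    finally show ?thesis unfolding resc[OF contp'] by (simp add: D_def E_def A_def e_def)
  qed
  \<comment> \<open>The true curvature is replaced by \<open>\<kappa>\<close> at the price of the term with \<open>\<delta>\<close>.\<close>
  have res: "(2 * \<epsilon> * laplacian u x - deriv W (u x) / \<epsilon>)\<^sup>2 * energy_density W \<epsilon> u x \<le> p (t (norm x)) / \<epsilon>" for x
  proof (cases "norm x \<in> {r0..r1}")
    case False
    then show ?thesis using e_out[OF False] by (simp add: ed p_def)
  next
    case True
    let ?s = "t (norm x)"
    define m where "m = real (DIM('a) - 1)"
    have m: "real DIM('a) = m + 1" "m \<ge> 0" using DIM_positive[where 'a = 'a] by (auto simp: m_def)
    have x: "norm x > 0" using True r0 by auto
    have "2 * \<epsilon> * laplacian u x = 2 * V2 ?s / \<epsilon> + 2 * m / norm x * V1 ?s"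
      unfolding u laplacian_square_radial[OF df df1 contf2] f1_norm f2_norm m(1)
      unfolding power2_norm_eq_inner[symmetric]
      using x \<epsilon> by (simp add: field_simps power2_eq_square)
    then have eq: "2 * \<epsilon> * laplacian u x - deriv W (u x) / \<epsilon> = A ?s + 2 * (m / norm x - \<kappa>) * V1 ?s"
      using \<epsilon> by (simp add: A_def profile_defect_def u_def t_def field_simps)
    have "m / r1 \<le> m / norm x" "m / norm x \<le> m / r0"
      using True x r0 m by (auto intro!: divide_left_mono)
    then have "\<bar>m / norm x - \<kappa>\<bar> \<le> \<delta>" by (simp add: \<kappa>_def \<delta>_def m_def)
    then have "(m / norm x - \<kappa>)\<^sup>2 \<le> \<delta>\<^sup>2" using abs_le_square_iff[of "m / norm x - \<kappa>" \<delta>] by linarith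
    then have "(m / norm x - \<kappa>)\<^sup>2 * (V1 ?s)\<^sup>2 \<le> \<delta>\<^sup>2 * B"
      using B by (intro mult_mono) auto
    moreover have "(A ?s + 2 * (m / norm x - \<kappa>) * V1 ?s)\<^sup>2 \<le>
        2 * (A ?s)\<^sup>2 + 2 * (2 * (m / norm x - \<kappa>) * V1 ?s)\<^sup>2"
      using zero_le_power2[of "A ?s - 2 * (m / norm x - \<kappa>) * V1 ?s"]
      unfolding power2_sum power2_diff by linarith
    ultimately have "(2 * \<epsilon> * laplacian u x - deriv W (u x) / \<epsilon>)\<^sup>2 \<le> 2 * (A ?s)\<^sup>2 + 8 * \<delta>\<^sup>2 * B"
      unfolding eq power_mult_distrib by simp
    from mult_right_mono[OF this, of "e ?s / \<epsilon>"] e0 \<epsilon>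
    show ?thesis by (simp add: ed p_def)
  qed
  have "G_fun W \<epsilon> u UNIV \<le> (\<integral>\<^sup>+x. ennreal (p (t (norm (x :: 'a))) / \<epsilon>) \<partial>lborel)"
    unfolding G_fun_def using res by (auto intro!: nn_integral_mono ennreal_leI)
  also have "\<dots> \<le> ennreal (sphere_area DIM('a) * r1 ^ (DIM('a) - 1) * (2 * D + 8 * \<delta>\<^sup>2 * B * E))"
    unfolding Gint[symmetric]
    by (rule shell(2)[OF contp']) (use p0 e_out \<epsilon> in \<open>auto simp: p_def\<close>)
  finally show "G_fun W \<epsilon> u UNIV \<le> \<dots>" .
qed

end

section \<open>Diagonal families and convergence to a Dirac mass\<close>

text \<open>
  If each of a decreasing sequence of properties is attainable for all small \<open>\<epsilon>\<close>, then a single family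
  has all of them eventually: take for each \<open>\<epsilon>\<close> the best attainable property with index at most \<open>1 / \<epsilon>\<close>.
  Where nothing is attainable the family takes the default value \<open>u0\<close>.
\<close>

lemma diagonal_family:
  fixes P :: "nat \<Rightarrow> real \<Rightarrow> 'u \<Rightarrow> bool"
  assumes ev: "\<And>k. \<forall>\<^sub>F \<epsilon> in at_right 0. \<exists>u. P k \<epsilon> u"
    and mono: "\<forall>k \<epsilon> u. P (Suc k) \<epsilon> u \<longrightarrow> P k \<epsilon> u"
  shows "\<exists>u. (\<forall>k. \<forall>\<^sub>F \<epsilon> in at_right 0. P k \<epsilon> (u \<epsilon>)) \<and> (\<forall>\<epsilon>. u \<epsilon> = u0 \<or> (\<exists>k. P k \<epsilon> (u \<epsilon>)))"
proof -
  define K where "K \<epsilon> = {k. real k \<le> 1 / \<epsilon> \<and> (\<exists>u. P k \<epsilon> u)}" for \<epsilon>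
  define u where "u \<epsilon> = (if K \<epsilon> = {} then u0 else SOME u. P (Max (K \<epsilon>)) \<epsilon> u)" for \<epsilon>
  have fin: "finite (K \<epsilon>)" for \<epsilon>
  proof (rule finite_subset)
    show "K \<epsilon> \<subseteq> {..nat \<lceil>1 / \<epsilon>\<rceil>}" by (auto simp: K_def) linarith
  qed simp
  have u: "P (Max (K \<epsilon>)) \<epsilon> (u \<epsilon>)" if "K \<epsilon> \<noteq> {}" for \<epsilon>
  proof -
    have "Max (K \<epsilon>) \<in> K \<epsilon>" using fin that by (rule Max_in)
    then have "\<exists>u. P (Max (K \<epsilon>)) \<epsilon> u" by (simp add: K_def)
    then show ?thesis using that by (simp add: u_def) (rule someI_ex)
  qed
  have down: "P k \<epsilon> v" if "P m \<epsilon> v" "k \<le> m" for k m \<epsilon> v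
    using that(2,1) by (induction rule: dec_induct) (use mono in auto)
  have "\<forall>\<^sub>F \<epsilon> in at_right 0. P k \<epsilon> (u \<epsilon>)" for k
  proof -
    have "\<forall>\<^sub>F \<epsilon> in at_right (0::real). \<epsilon> < 1 / (real k + 1)"
      by (rule eventually_at_right_field[THEN iffD2]) (auto intro!: exI[of _ "1 / (real k + 1)"])
    then show ?thesis
      using ev[of k] eventually_at_right_less[of 0]
    proof eventually_elim
      case (elim \<epsilon>)
      then have "real k * \<epsilon> \<le> 1" by (simp add: field_simps)
      then have "k \<in> K \<epsilon>" using elim by (simp add: K_def field_simps)
      then show ?case using down[OF u, of \<epsilon> k] fin by auto
    qed
  qed
  moreover have "u \<epsilon> = u0 \<or> (\<exists>k. P k \<epsilon> (u \<epsilon>))" for \<epsilon>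
    using u[of \<epsilon>] by (cases "K \<epsilon> = {}") (auto simp: u_def)
  ultimately show ?thesis by blast
qed

lemma weak_star_conv_diracI:
  fixes \<mu> :: "'i \<Rightarrow> 'a::euclidean_space measure"
  assumes sets: "\<And>i. sets (\<mu> i) = sets borel"
    and mass: "\<And>k. \<forall>\<^sub>F i in F. 1 \<le> emeasure (\<mu> i) UNIV \<and> emeasure (\<mu> i) UNIV \<le> ennreal (1 + 1 / real (Suc k))"
    and supp: "\<And>k. \<forall>\<^sub>F i in F. emeasure (\<mu> i) (- cball 0 (1 / real (Suc k))) = 0"
  shows "weak_star_conv \<mu> (return borel 0) F"
  unfolding weak_star_conv_def
proof (intro conjI ballI)
  have space: "space (\<mu> i) = UNIV" for i
    using sets_eq_imp_space_eq[OF sets[of i]] by simp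
  show "\<forall>\<^sub>F i in F. finite_measure (\<mu> i) \<and> sets (\<mu> i) = sets borel"
    using mass[of 0]
  proof eventually_elim
    case (elim i)
    then have "emeasure (\<mu> i) (space (\<mu> i)) \<noteq> \<infinity>"
      unfolding space by (auto simp: top_unique)
    then show ?case using sets by (auto intro: finite_measureI)
  qed
  show "finite_measure (return borel (0::'a))"
    by (rule prob_space.finite_measure[OF prob_space_return]) simp
  show "sets (return borel (0::'a)) = sets borel" by simp
  fix \<phi> :: "'a \<Rightarrow> real" assume "\<phi> \<in> C0_functions"
  then have cont: "continuous_on UNIV \<phi>" by (simp add: C0_functions_def)
  then have meas [measurable]: "\<phi> \<in> borel_measurable borel" by (rule borel_measurable_continuous_onI)
  have "((\<lambda>i. \<integral>x. \<phi> x \<partial>\<mu> i) \<longlongrightarrow> \<phi> 0) F"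
  proof (rule tendstoI)
    fix e :: real assume e: "e > 0"
    have "isCont \<phi> 0" using cont by (simp add: continuous_on_eq_continuous_at)
    then obtain d where d: "d > 0" "\<And>x. norm x < d \<Longrightarrow> \<bar>\<phi> x - \<phi> 0\<bar> < e / 4"
      using e unfolding continuous_at_eps_delta dist_norm real_norm_def
      by (metis diff_zero divide_pos_pos zero_less_numeral)
    obtain k1 where k1: "1 / real (Suc k1) < d" using d(1) nat_approx_posE by blast
    have "e / (4 * (\<bar>\<phi> 0\<bar> + 1)) > 0" using e by simp
    then obtain k2 where k2: "1 / real (Suc k2) < e / (4 * (\<bar>\<phi> 0\<bar> + 1))"
      using nat_approx_posE by blast
    show "\<forall>\<^sub>F i in F. dist (\<integral>x. \<phi> x \<partial>\<mu> i) (\<phi> 0) < e"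
      using mass[of k2] supp[of k1]
    proof eventually_elim
      case (elim i)
      then have "emeasure (\<mu> i) (space (\<mu> i)) \<noteq> \<infinity>"
        unfolding space by (auto simp: top_unique)
      then interpret finite_measure "\<mu> i" by (rule finite_measureI)
      define m where "m = measure (\<mu> i) UNIV"
      have em: "emeasure (\<mu> i) UNIV = ennreal m" unfolding m_def by (rule emeasure_eq_measure)
      have m: "1 \<le> m" "m \<le> 1 + 1 / real (Suc k2)"
      proof -
        have "ennreal 1 \<le> ennreal m" "ennreal m \<le> ennreal (1 + 1 / real (Suc k2))"
          using elim(1) unfolding em by (simp_all only: ennreal_1)
        moreover have "0 \<le> m" by (simp add: m_def)
        moreover have "0 \<le> 1 + 1 / real (Suc k2)" by simp
        ultimately show "1 \<le> m" "m \<le> 1 + 1 / real (Suc k2)" by (simp_all only: ennreal_le_iff)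
      qed
      have [measurable]: "\<phi> \<in> borel_measurable (\<mu> i)"
        by (subst measurable_cong_sets[OF sets refl]) (rule meas)
      have AE: "AE x in \<mu> i. \<bar>\<phi> x - \<phi> 0\<bar> \<le> e / 4"
      proof (rule AE_I[OF _ elim(2)])
        show "- cball 0 (1 / real (Suc k1)) \<in> sets (\<mu> i)" unfolding sets by auto
        show "{x \<in> space (\<mu> i). \<not> \<bar>\<phi> x - \<phi> 0\<bar> \<le> e / 4} \<subseteq> - cball 0 (1 / real (Suc k1))"
        proof clarify
          fix x assume "\<not> \<bar>\<phi> x - \<phi> 0\<bar> \<le> e / 4" "x \<in> cball 0 (1 / real (Suc k1))"
          then have "norm x < d" using k1 by (simp only: mem_cball dist_0_norm)
          then show False using d(2)[of x] \<open>\<not> \<bar>\<phi> x - \<phi> 0\<bar> \<le> e / 4\<close> by simp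
        qed
      qed
      \<comment> \<open>The measure lives on a small ball, on which \<open>\<phi>\<close> is nearly constant.\<close>
      have int: "integrable (\<mu> i) (\<lambda>x. \<phi> x - \<phi> 0)"
        by (rule integrable_const_bound[of _ "e / 4"]) (use AE in auto)
      have "(\<integral>x. \<phi> x \<partial>\<mu> i) = (\<integral>x. (\<phi> x - \<phi> 0) + \<phi> 0 \<partial>\<mu> i)" by simp
      also have "\<dots> = (\<integral>x. \<phi> x - \<phi> 0 \<partial>\<mu> i) + \<phi> 0 * m"
        by (subst Bochner_Integration.integral_add[OF int]) (auto simp: m_def space)
      finally have eq: "(\<integral>x. \<phi> x \<partial>\<mu> i) - \<phi> 0 = (\<integral>x. \<phi> x - \<phi> 0 \<partial>\<mu> i) + \<phi> 0 * (m - 1)"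
        by (simp add: algebra_simps)
      have "\<bar>\<integral>x. \<phi> x - \<phi> 0 \<partial>\<mu> i\<bar> \<le> (\<integral>x. \<bar>\<phi> x - \<phi> 0\<bar> \<partial>\<mu> i)"
        by (rule integral_abs_bound)
      also have "\<dots> \<le> (\<integral>x. e / 4 \<partial>\<mu> i)"
        by (rule integral_mono_AE) (use int AE in auto)
      also have "\<dots> = e / 4 * m" by (simp add: m_def space)
      also have "\<dots> \<le> e / 4 * 2"
        using m e by (intro mult_left_mono) (auto intro: order_trans[OF m(2)])
      finally have 1: "\<bar>\<integral>x. \<phi> x - \<phi> 0 \<partial>\<mu> i\<bar> \<le> e / 2" by simp
      have "\<bar>\<phi> 0 * (m - 1)\<bar> \<le> (\<bar>\<phi> 0\<bar> + 1) * (1 / real (Suc k2))"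
        unfolding abs_mult using m by (intro mult_mono) auto
      also have "\<dots> < (\<bar>\<phi> 0\<bar> + 1) * (e / (4 * (\<bar>\<phi> 0\<bar> + 1)))"
        using k2 by (intro mult_strict_left_mono) auto
      also have "\<dots> = e / 4" by (simp add: field_simps)
      finally show ?case using 1 eq e unfolding dist_real_def by linarith
    qed
  qed
  then show "((\<lambda>i. \<integral>x. \<phi> x \<partial>\<mu> i) \<longlongrightarrow> (\<integral>x. \<phi> x \<partial>return borel 0)) F"
    by (simp add: integral_return)
qed

section \<open>Concentration of the energy at the origin\<close>

lemma henstock_integral_nonneg:
  fixes f :: "real \<Rightarrow> real"
  assumes "\<And>x. 0 \<le> f x"
  shows "0 \<le> integral S f"
proof (cases "f integrable_on S")
  case True
  then show ?thesis using assms by (rule Henstock_Kurzweil_Integration.integral_nonneg)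
qed (simp add: not_integrable_integral)

context double_well
begin

lemma sigma_W_pos: "0 < sigma_W W a b"
proof -
  let ?w = "\<lambda>s. sqrt (W s)"
  have cont: "continuous_on {a..b} ?w" by (intro continuous_intros continuous_on_W)
  have "integral {a..b} ?w \<noteq> 0"
  proof
    assume 0: "integral {a..b} ?w = 0"
    have "(?w has_integral 0) {a..b}"
      using integrable_integral[OF integrable_continuous_interval[OF cont]] unfolding 0 .
    then have "?w ((a + b) / 2) = 0"
      using has_integral_0_cbox_imp_0[of a b ?w "(a + b) / 2"] cont W_nonneg wells(1) by simp
    then show False using wells(4)[of "(a + b) / 2"] wells(1) by simp
  qed
  moreover have "0 \<le> integral {a..b} ?w"
    by (rule Henstock_Kurzweil_Integration.integral_nonneg)
      (use W_nonneg integrable_continuous_interval[OF cont] in auto)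
  ultimately show ?thesis by (simp add: sigma_W_def)
qed

text \<open>
  The function \<open>u\<close> has its energy in the ball of radius \<open>1 / (k + 1)\<close> around the origin, with total mass
  within a factor \<open>1 + 1 / (k + 1)\<close> of \<open>sigma_W W a b\<close>, and \<open>G\<close> is at most \<open>C\<close>. The condition gets
  stronger as \<open>k\<close> grows.
\<close>

definition concentrated :: "real \<Rightarrow> nat \<Rightarrow> real \<Rightarrow> ('a::euclidean_space \<Rightarrow> real) \<Rightarrow> bool" where
  "concentrated C k \<epsilon> u \<longleftrightarrow> C2 u \<and> continuous_on UNIV (energy_density W \<epsilon> u) \<and>
     (\<forall>x. 0 \<le> energy_density W \<epsilon> u x) \<and>
     (\<forall>x. norm x > 1 / real (Suc k) \<longrightarrow> energy_density W \<epsilon> u x = 0) \<and>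
     ennreal (sigma_W W a b) \<le> E_fun W \<epsilon> u UNIV \<and>
     E_fun W \<epsilon> u UNIV \<le> ennreal (sigma_W W a b * (1 + 1 / real (Suc k))) \<and>
     G_fun W \<epsilon> u UNIV \<le> ennreal C"

lemma concentratedD:
  assumes "concentrated C k \<epsilon> u"
  shows "C2 u" and "continuous_on UNIV (energy_density W \<epsilon> u)"
    and "0 \<le> energy_density W \<epsilon> u x"
    and "norm x > 1 / real (Suc k) \<Longrightarrow> energy_density W \<epsilon> u x = 0"
    and "ennreal (sigma_W W a b) \<le> E_fun W \<epsilon> u UNIV"
    and "E_fun W \<epsilon> u UNIV \<le> ennreal (sigma_W W a b * (1 + 1 / real (Suc k)))"
    and "G_fun W \<epsilon> u UNIV \<le> ennreal C"
  using assms unfolding concentrated_def by blast+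

lemma concentrated_Suc: "concentrated C (Suc k) \<epsilon> u \<Longrightarrow> concentrated C k \<epsilon> u"
proof -
  assume "concentrated C (Suc k) \<epsilon> u"
  note u' = concentratedD[OF this]
  have le: "1 / real (Suc (Suc k)) \<le> 1 / real (Suc k)" by (intro divide_left_mono) auto
  have "ennreal (sigma_W W a b * (1 + 1 / real (Suc (Suc k)))) \<le> ennreal (sigma_W W a b * (1 + 1 / real (Suc k)))"
    using le sigma_W_pos by (intro ennreal_leI mult_left_mono add_left_mono) auto
  from order_trans[OF u'(6) this]
  have E: "E_fun W \<epsilon> u UNIV \<le> ennreal (sigma_W W a b * (1 + 1 / real (Suc k)))" .
  have "energy_density W \<epsilon> u x = 0" if "norm x > 1 / real (Suc k)" for x
    using u'(4) le_less_trans[OF le that] by simp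
  then show ?thesis
    unfolding concentrated_def using u'(1,2,3,5,7) E by (intro conjI allI impI) simp_all
qed

text \<open>
  The radius \<open>r0\<close> is chosen such that \<open>N = 2 M0\<close> spheres of this radius have total area exactly 1, with \<open>M0\<close>
  so large that \<open>r0\<close> is small. As \<open>\<epsilon>\<close> tends to 0 the outer radius of the layer is at most
  \<open>R \<epsilon>\<close>, which tends to \<open>r0\<close>.
\<close>

lemma eventually_concentrated:
  assumes n: "DIM('a::euclidean_space) \<ge> 2"
  shows "\<exists>C. \<forall>k. \<forall>\<^sub>F \<epsilon> in at_right 0. \<exists>u :: 'a \<Rightarrow> real. concentrated C k \<epsilon> u"
proof -
  obtain K C B where trans: "\<forall>\<kappa> \<eta>. 0 < \<eta> \<longrightarrow>
    (\<forall>\<^sub>F \<epsilon> in at_right 0. \<exists>T V V1 V2. profile a b T V V1 V2 \<and> T \<le> K / sqrt \<epsilon> \<and>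
      (\<forall>t. (V1 t)\<^sup>2 \<le> B) \<and>
      sigma_W W a b \<le> integral {0..T} (profile_density W V V1) \<and>
      integral {0..T} (profile_density W V V1) \<le> sigma_W W a b + \<eta> \<and>
      integral {0..T} (\<lambda>t. (profile_defect W \<epsilon> \<kappa> V V1 V2 t)\<^sup>2 * profile_density W V V1 t) \<le> C)"
    using transition_exists by (elim exE)
  \<comment> \<open>The transition in terms of \<open>has_path\<close>, with its energy and its cost as separate variables.\<close>
  have half: "\<forall>\<^sub>F \<epsilon> in at_right 0. \<exists>T E D. has_path \<epsilon> \<kappa> B a b T E D \<and> 0 \<le> T \<and> 0 \<le> B \<and> T \<le> K / sqrt \<epsilon> \<and>
      sigma_W W a b \<le> E \<and> E \<le> sigma_W W a b + \<eta> \<and> D \<le> C" if "\<eta> > 0" for \<kappa> \<eta>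
    using trans[rule_format, OF that, of \<kappa>]
  proof eventually_elim
    case (elim \<epsilon>)
    then obtain T V V1 V2 where *: "profile a b T V V1 V2 \<and> T \<le> K / sqrt \<epsilon> \<and>
      (\<forall>t. (V1 t)\<^sup>2 \<le> B) \<and>
      sigma_W W a b \<le> integral {0..T} (profile_density W V V1) \<and>
      integral {0..T} (profile_density W V V1) \<le> sigma_W W a b + \<eta> \<and>
      integral {0..T} (\<lambda>t. (profile_defect W \<epsilon> \<kappa> V V1 V2 t)\<^sup>2 * profile_density W V V1 t) \<le> C"
      by (elim exE)
    then have "0 \<le> B" using zero_le_power2 order_trans by blast
    moreover have "0 \<le> T" using * by (simp add: profile_def)
    moreover have "has_path \<epsilon> \<kappa> B a b T (integral {0..T} (profile_density W V V1))
      (integral {0..T} (\<lambda>t. (profile_defect W \<epsilon> \<kappa> V V1 V2 t)\<^sup>2 * profile_density W V V1 t))"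
      unfolding has_path_def using * by (intro exI conjI refl) blast+
    ultimately show ?case using * by blast
  qed
  define \<sigma> where "\<sigma> = sigma_W W a b"
  have \<sigma>: "\<sigma> > 0" using sigma_W_pos by (simp add: \<sigma>_def)
  define \<omega> where "\<omega> = sphere_area DIM('a)"
  have \<omega>: "\<omega> > 0" unfolding \<omega>_def by (rule sphere_area_pos) simp
  define m where "m = DIM('a) - 1"
  have m: "m > 0" using n by (simp add: m_def)
  have "\<forall>\<^sub>F \<epsilon> in at_right 0. \<exists>u :: 'a \<Rightarrow> real. concentrated (2 * C + 1) k \<epsilon> u" for k
  proof -
    define q where "q = (1 / (2 * real (Suc k))) ^ m"
    have q: "q > 0" by (simp add: q_def)
    obtain M0 :: nat where M0: "1 / (2 * \<omega> * q) < real M0" using reals_Archimedean2 by blast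
    define N where "N = 2 * real M0"
    have "0 < 1 / (2 * \<omega> * q)" using \<omega> q by simp
    then have "real M0 > 0" using M0 by linarith
    then have N: "N > 0" by (simp add: N_def)
    define r0 where "r0 = root m (1 / (N * \<omega>))"
    have r0: "r0 > 0" using m N \<omega> by (simp add: r0_def)
    have area: "\<omega> * r0 ^ m * N = 1"
    proof -
      have "r0 ^ m = 1 / (N * \<omega>)" unfolding r0_def using m N \<omega> by (intro real_root_pow_pos2) auto
      then show ?thesis using N \<omega> by simp
    qed
    have r0_small: "r0 < 1 / (2 * real (Suc k))"
    proof (rule power_less_imp_less_base[of _ m])
      have "1 < \<omega> * q * N" using M0 \<omega> q by (simp add: N_def field_simps)
      then have "\<omega> * r0 ^ m * N < \<omega> * q * N" unfolding area .
      then have "r0 ^ m < q" using \<omega> N by simp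
      then show "r0 ^ m < (1 / (2 * real (Suc k))) ^ m" unfolding q_def .
    qed simp
    define \<kappa> where "\<kappa> = real m / r0"
    define \<eta> where "\<eta> = \<sigma> / (2 * real (Suc k))"
    have \<eta>: "\<eta> > 0" using \<sigma> by (simp add: \<eta>_def)
    define R where "R \<epsilon> = r0 + N * K * sqrt \<epsilon>" for \<epsilon>
    define \<Delta> where "\<Delta> \<epsilon> = real m / r0 - real m / R \<epsilon>" for \<epsilon>
    have contR: "isCont R 0" unfolding R_def by (intro continuous_intros)
    have R0: "R 0 = r0" by (simp add: R_def)
    have cont\<Delta>: "isCont \<Delta> 0" unfolding \<Delta>_def using r0 R0 by (intro continuous_intros contR) auto
    have \<Delta>0: "\<Delta> 0 = 0" by (simp add: \<Delta>_def R0)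
    have small: "\<forall>\<^sub>F \<epsilon> in at_right 0. f \<epsilon> < y" if "isCont f 0" "f 0 < y" for f :: "real \<Rightarrow> real" and y
      using that by (metis order_tendstoD(2) filterlim_at_split isCont_def)
    have ev1: "\<forall>\<^sub>F \<epsilon> in at_right 0. R \<epsilon> < 1 / real (Suc k)"
    proof (rule small[OF contR])
      have "1 / (2 * real (Suc k)) \<le> 1 / real (Suc k)" by (intro divide_left_mono) auto
      then show "R 0 < 1 / real (Suc k)" using r0_small R0 by linarith
    qed
    have split: "\<sigma> + 2 * (\<sigma> / (2 * y)) = \<sigma> * (1 + 1 / y)" for y :: real
      by (cases "y = 0") (simp_all add: field_simps)
    have ev2: "\<forall>\<^sub>F \<epsilon> in at_right 0. \<omega> * R \<epsilon> ^ m * (N * (\<sigma> + \<eta>)) < \<sigma> * (1 + 1 / real (Suc k))"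
    proof (rule small)
      have "\<omega> * R 0 ^ m * (N * (\<sigma> + \<eta>)) = (\<omega> * r0 ^ m * N) * (\<sigma> + \<eta>)" by (simp add: R0)
      also have "\<dots> = \<sigma> + \<eta>" unfolding area by simp
      also have "\<dots> < \<sigma> + 2 * \<eta>" using \<eta> by simp
      also have "\<dots> = \<sigma> * (1 + 1 / real (Suc k))" unfolding \<eta>_def by (rule split)
      finally show "\<omega> * R 0 ^ m * (N * (\<sigma> + \<eta>)) < \<sigma> * (1 + 1 / real (Suc k))" .
    qed (intro continuous_intros contR)
    have ev3: "\<forall>\<^sub>F \<epsilon> in at_right 0. \<omega> * R \<epsilon> ^ m * (2 * (N * C) + 8 * (\<Delta> \<epsilon>)\<^sup>2 * B * (N * (\<sigma> + \<eta>))) < 2 * C + 1"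
    proof (rule small)
      have "\<omega> * R 0 ^ m * (2 * (N * C) + 8 * (\<Delta> 0)\<^sup>2 * B * (N * (\<sigma> + \<eta>))) = (\<omega> * r0 ^ m * N) * (2 * C)"
        by (simp add: R0 \<Delta>0)
      then show "\<omega> * R 0 ^ m * (2 * (N * C) + 8 * (\<Delta> 0)\<^sup>2 * B * (N * (\<sigma> + \<eta>))) < 2 * C + 1"
        unfolding area by simp
    qed (intro continuous_intros contR cont\<Delta>)
    show ?thesis
      using ev1 ev2 ev3 half[OF \<eta>, of \<kappa>] half[OF \<eta>, of "- \<kappa>"] eventually_at_right_less[of 0]
    proof eventually_elim
      case (elim \<epsilon>)
      then have \<epsilon>: "\<epsilon> > 0" by simp
      obtain T1 E1 D1 where up: "has_path \<epsilon> \<kappa> B a b T1 E1 D1 \<and> 0 \<le> T1 \<and> 0 \<le> B \<and> T1 \<le> K / sqrt \<epsilon> \<and>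
          sigma_W W a b \<le> E1 \<and> E1 \<le> sigma_W W a b + \<eta> \<and> D1 \<le> C"
        using elim(4) by (elim exE)
      obtain T2 E2 D2 where down: "has_path \<epsilon> (- \<kappa>) B a b T2 E2 D2 \<and> 0 \<le> T2 \<and> 0 \<le> B \<and> T2 \<le> K / sqrt \<epsilon> \<and>
          sigma_W W a b \<le> E2 \<and> E2 \<le> sigma_W W a b + \<eta> \<and> D2 \<le> C"
        using elim(5) by (elim exE)
      have up': "0 \<le> T1" "0 \<le> B" "T1 \<le> K / sqrt \<epsilon>" "\<sigma> \<le> E1" "E1 \<le> \<sigma> + \<eta>" "D1 \<le> C"
        using up unfolding \<sigma>_def by simp_all
      have down': "0 \<le> T2" "T2 \<le> K / sqrt \<epsilon>" "\<sigma> \<le> E2" "E2 \<le> \<sigma> + \<eta>" "D2 \<le> C"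
        using down unfolding \<sigma>_def by simp_all
      note B = up'(2)
      define T E D where "T = real M0 * (T1 + T2)" and "E = real M0 * (E1 + E2)" and "D = real M0 * (D1 + D2)"
      \<comment> \<open>\<open>M0\<close> repetitions of a transition up followed by a reversed transition.\<close>
      have "has_path \<epsilon> \<kappa> B a a T E D"
        unfolding T_def E_def D_def
        by (rule has_path_repeat[OF has_path_append[OF conjunct1[OF up] has_path_reverse[OF conjunct1[OF down]]] B])
      then obtain V V1 V2 where V: "profile a a T V V1 V2 \<and> (\<forall>t. (V1 t)\<^sup>2 \<le> B) \<and>
          integral {0..T} (profile_density W V V1) = E \<and>
          integral {0..T} (\<lambda>t. (profile_defect W \<epsilon> \<kappa> V V1 V2 t)\<^sup>2 * profile_density W V V1 t) = D"
        unfolding has_path_def by (elim exE)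
      define u where "u = (\<lambda>x::'a. V ((norm x - r0) / \<epsilon>))"
      define r1 where "r1 = r0 + \<epsilon> * T"
      have T0: "0 \<le> T" using up'(1) down'(1) by (simp add: T_def)
      have r1: "r0 \<le> r1" "r1 \<le> R \<epsilon>"
      proof -
        show "r0 \<le> r1" using T0 \<epsilon> by (simp add: r1_def)
        have "T \<le> real M0 * (K / sqrt \<epsilon> + K / sqrt \<epsilon>)"
          unfolding T_def using up' down' by (intro mult_left_mono add_mono) auto
        then have "\<epsilon> * T \<le> \<epsilon> * (N * (K / sqrt \<epsilon>))"
          using \<epsilon> by (intro mult_left_mono) (auto simp: N_def mult_ac)
        also have "\<dots> = N * K * sqrt \<epsilon>"
          using \<epsilon> by (simp add: real_div_sqrt field_simps flip: power2_eq_square)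
        finally show "r1 \<le> R \<epsilon>" by (simp add: r1_def R_def)
      qed
      have E: "N * \<sigma> \<le> E" "E \<le> N * (\<sigma> + \<eta>)"
      proof -
        have "real M0 * (\<sigma> + \<sigma>) \<le> E" "E \<le> real M0 * ((\<sigma> + \<eta>) + (\<sigma> + \<eta>))"
          unfolding E_def by (intro mult_left_mono add_mono up' down'; simp)+
        then show "N * \<sigma> \<le> E" "E \<le> N * (\<sigma> + \<eta>)"
          unfolding N_def by (simp_all add: algebra_simps)
      qed
      have "D \<le> real M0 * (C + C)"
        unfolding D_def using up' down' by (intro mult_left_mono add_mono) auto
      then have D: "D \<le> N * C" by (simp add: N_def)
      define \<delta> where "\<delta> = real m / r0 - real m / r1"
      have \<delta>: "0 \<le> \<delta>" "\<delta> \<le> \<Delta> \<epsilon>"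
        using r0 r1 by (auto simp: \<delta>_def \<Delta>_def intro!: divide_left_mono)
      have pow: "r1 ^ m \<le> R \<epsilon> ^ m" "0 \<le> r1 ^ m" using r0 r1 by (auto intro!: power_mono)
      have E0: "0 \<le> E" using E(1) mult_pos_pos[OF N \<sigma>] by linarith
      have prof: "profile a a T V V1 V2" and bd: "\<And>t. (V1 t)\<^sup>2 \<le> B"
        and EV: "integral {0..T} (profile_density W V V1) = E"
        and DV: "integral {0..T} (\<lambda>t. (profile_defect W \<epsilon> (real (DIM('a) - 1) / r0) V V1 V2 t)\<^sup>2 * profile_density W V V1 t) = D"
        using V by (auto simp: \<kappa>_def m_def)
      note layer = radial_layer[where 'a = 'a, OF prof bd \<epsilon> r0, folded u_def r1_def m_def,
          folded \<delta>_def, unfolded EV DV[folded m_def], folded \<omega>_def]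
      have "concentrated (2 * C + 1) k \<epsilon> u"
        unfolding concentrated_def
      proof (intro conjI allI impI)
        show "C2 u" "continuous_on UNIV (energy_density W \<epsilon> u)" by (fact layer)+
        show "0 \<le> energy_density W \<epsilon> u x" for x by (fact layer)
        show "energy_density W \<epsilon> u x = 0" if "norm x > 1 / real (Suc k)" for x
          by (rule layer(4)) (use that elim(1) r1 in linarith)
        have "\<sigma> = (\<omega> * r0 ^ m * N) * \<sigma>" unfolding area by simp
        also have "\<dots> = \<omega> * r0 ^ m * (N * \<sigma>)" by simp
        also have "\<dots> \<le> \<omega> * r0 ^ m * E" using \<omega> r0 E by (intro mult_left_mono) auto
        finally show "ennreal (sigma_W W a b) \<le> E_fun W \<epsilon> u UNIV"
          using layer(5) by (metis \<sigma>_def ennreal_leI order_trans)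
        have "\<omega> * r1 ^ m * E \<le> \<omega> * R \<epsilon> ^ m * (N * (\<sigma> + \<eta>))"
          using \<omega> pow E E0 by (intro mult_mono) auto
        also have "\<dots> \<le> \<sigma> * (1 + 1 / real (Suc k))" using elim(2) by simp
        finally show "E_fun W \<epsilon> u UNIV \<le> ennreal (sigma_W W a b * (1 + 1 / real (Suc k)))"
          using layer(6) by (metis \<sigma>_def ennreal_leI order_trans)
        have D0: "0 \<le> D" unfolding DV[symmetric]
          using W_nonneg by (intro henstock_integral_nonneg) (simp add: profile_density_def)
        have "2 * D + 8 * \<delta>\<^sup>2 * B * E \<le> 2 * (N * C) + 8 * (\<Delta> \<epsilon>)\<^sup>2 * B * (N * (\<sigma> + \<eta>))"
          using D D0 \<delta> B E E0 by (intro add_mono mult_mono power_mono) auto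
        moreover have "0 \<le> 2 * D + 8 * \<delta>\<^sup>2 * B * E" using D0 B E0 by simp
        ultimately have "\<omega> * r1 ^ m * (2 * D + 8 * \<delta>\<^sup>2 * B * E) \<le>
            \<omega> * R \<epsilon> ^ m * (2 * (N * C) + 8 * (\<Delta> \<epsilon>)\<^sup>2 * B * (N * (\<sigma> + \<eta>)))"
          using \<omega> pow by (intro mult_mono) auto
        also have "\<dots> \<le> 2 * C + 1" using elim(3) by simp
        finally show "G_fun W \<epsilon> u UNIV \<le> ennreal (2 * C + 1)"
          using layer(7) by (metis ennreal_leI order_trans)
      qed
      then show ?case by blast
    qed
  qed
  then show ?thesis by blast
qed

end

theorem corollary2p3:
  fixes W :: "real \<Rightarrow> real" and a b :: real
  assumes n_ge_2: "CARD('n::finite) \<ge> 2"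
    and W_nonneg: "\<And>s. W s \<ge> 0"
    and W1: "C2 W"
    and W2: "a < b" "W a = 0" "W b = 0" "\<And>s. s \<in> {a<..<b} \<Longrightarrow> W s > 0"
    and W3: "deriv (deriv W) a > 0" "deriv (deriv W) b > 0"
  shows "\<exists>u :: real \<Rightarrow> (real ^ 'n) \<Rightarrow> real.
    (\<forall>\<epsilon>>0. C2 (u \<epsilon>)) \<and>
    Limsup (at_right 0) (\<lambda>\<epsilon>. E_fun W \<epsilon> (u \<epsilon>) UNIV + G_fun W \<epsilon> (u \<epsilon>) UNIV) < \<infinity> \<and>
    weak_star_conv (\<lambda>\<epsilon>. energy_measure W a b \<epsilon> (u \<epsilon>)) (return borel 0) (at_right 0)"
proof -
  interpret double_well W a b using assms by unfold_locales
  define \<sigma> where "\<sigma> = sigma_W W a b"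
  have \<sigma>: "\<sigma> > 0" using sigma_W_pos by (simp add: \<sigma>_def)
  have dim: "DIM(real ^ 'n) \<ge> 2" using n_ge_2 by simp
  have "\<exists>C. \<forall>k. \<forall>\<^sub>F \<epsilon> in at_right 0. \<exists>u :: real ^ 'n \<Rightarrow> real. concentrated C k \<epsilon> u"
    by (rule eventually_concentrated[OF dim])
  then obtain C where C: "\<forall>k. \<forall>\<^sub>F \<epsilon> in at_right 0. \<exists>u :: real ^ 'n \<Rightarrow> real. concentrated C k \<epsilon> u"
    by (rule exE)
  have mono: "\<forall>k \<epsilon> (u :: real ^ 'n \<Rightarrow> real). concentrated C (Suc k) \<epsilon> u \<longrightarrow> concentrated C k \<epsilon> u"
    by (intro allI impI) (rule concentrated_Suc)
  obtain u :: "real \<Rightarrow> real ^ 'n \<Rightarrow> real" where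
    u: "(\<forall>k. \<forall>\<^sub>F \<epsilon> in at_right 0. concentrated C k \<epsilon> (u \<epsilon>)) \<and>
      (\<forall>\<epsilon>. u \<epsilon> = (\<lambda>_. 0) \<or> (\<exists>k. concentrated C k \<epsilon> (u \<epsilon>)))"
    using diagonal_family[where P = "concentrated C" and ?u0.0 = "\<lambda>_ :: real ^ 'n. 0", OF C[rule_format] mono]
    by (elim exE)
  have ev: "\<forall>\<^sub>F \<epsilon> in at_right 0. concentrated C k \<epsilon> (u \<epsilon>)" for k
    using conjunct1[OF u] by (rule spec)
  show ?thesis
  proof (intro exI[of _ u] conjI allI impI)
    fix \<epsilon> :: real
    have "u \<epsilon> = (\<lambda>_. 0) \<or> (\<exists>k. concentrated C k \<epsilon> (u \<epsilon>))"
      using conjunct2[OF u] by (rule spec)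
    then show "C2 (u \<epsilon>)"
    proof
      assume "u \<epsilon> = (\<lambda>_. 0)"
      moreover have "C2 (\<lambda>_ :: real ^ 'n. 0 :: real)"
        unfolding C2_def by (rule exI[of _ "\<lambda>_. 0"], rule exI[of _ "\<lambda>_. 0"])
            (simp add: zero_blinfun.rep_eq)
      ultimately show ?thesis by simp
    next
      assume "\<exists>k. concentrated C k \<epsilon> (u \<epsilon>)"
      then show ?thesis using concentratedD(1) by (elim exE)
    qed
  next
    have "Limsup (at_right 0) (\<lambda>\<epsilon>. E_fun W \<epsilon> (u \<epsilon>) UNIV + G_fun W \<epsilon> (u \<epsilon>) UNIV)
        \<le> ennreal (\<sigma> * (1 + 1 / real (Suc 0))) + ennreal C"
    proof (rule Limsup_bounded)
      show "\<forall>\<^sub>F \<epsilon> in at_right 0. E_fun W \<epsilon> (u \<epsilon>) UNIV + G_fun W \<epsilon> (u \<epsilon>) UNIV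
          \<le> ennreal (\<sigma> * (1 + 1 / real (Suc 0))) + ennreal C"
        using ev[of 0] unfolding \<sigma>_def
        by eventually_elim (intro add_mono concentratedD(6,7))
    qed
    also have "\<dots> < \<infinity>" by (simp add: less_top)
    finally show "Limsup (at_right 0) (\<lambda>\<epsilon>. E_fun W \<epsilon> (u \<epsilon>) UNIV + G_fun W \<epsilon> (u \<epsilon>) UNIV) < \<infinity>" .
  next
    have emeas: "emeasure (energy_measure W a b \<epsilon> (u \<epsilon>)) A =
        ennreal (1 / \<sigma>) * (\<integral>\<^sup>+x. ennreal (energy_density W \<epsilon> (u \<epsilon>) x) * indicator A x \<partial>lborel)"
      if conc: "concentrated C k \<epsilon> (u \<epsilon>)" and [measurable]: "A \<in> sets borel" for k \<epsilon> A
    proof -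
      have [measurable]: "energy_density W \<epsilon> (u \<epsilon>) \<in> borel_measurable borel"
        by (rule borel_measurable_continuous_onI[OF concentratedD(2)[OF conc]])
      have "emeasure (energy_measure W a b \<epsilon> (u \<epsilon>)) A =
          (\<integral>\<^sup>+x. ennreal (1 / \<sigma> * energy_density W \<epsilon> (u \<epsilon>) x) * indicator A x \<partial>lborel)"
        unfolding energy_measure_def \<sigma>_def by (subst emeasure_density) auto
      also have "\<dots> = (\<integral>\<^sup>+x. ennreal (1 / \<sigma>) * (ennreal (energy_density W \<epsilon> (u \<epsilon>) x) * indicator A x) \<partial>lborel)"
      proof (rule nn_integral_cong)
        fix x
        have "ennreal (1 / \<sigma> * energy_density W \<epsilon> (u \<epsilon>) x) =
            ennreal (1 / \<sigma>) * ennreal (energy_density W \<epsilon> (u \<epsilon>) x)"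
          using \<sigma> concentratedD(3)[OF conc] by (intro ennreal_mult) auto
        then show "ennreal (1 / \<sigma> * energy_density W \<epsilon> (u \<epsilon>) x) * indicator A x =
            ennreal (1 / \<sigma>) * (ennreal (energy_density W \<epsilon> (u \<epsilon>) x) * indicator A x)"
          by (simp only: mult.assoc)
      qed
      also have "\<dots> = ennreal (1 / \<sigma>) * (\<integral>\<^sup>+x. ennreal (energy_density W \<epsilon> (u \<epsilon>) x) * indicator A x \<partial>lborel)"
        by (rule nn_integral_cmult) measurable
      finally show ?thesis .
    qed
    show "weak_star_conv (\<lambda>\<epsilon>. energy_measure W a b \<epsilon> (u \<epsilon>)) (return borel 0) (at_right 0)"
    proof (rule weak_star_conv_diracI)
      show "sets (energy_measure W a b \<epsilon> (u \<epsilon>)) = sets borel" for \<epsilon>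
        by (simp add: energy_measure_def)
      fix k
      show "\<forall>\<^sub>F \<epsilon> in at_right 0. 1 \<le> emeasure (energy_measure W a b \<epsilon> (u \<epsilon>)) UNIV \<and>
          emeasure (energy_measure W a b \<epsilon> (u \<epsilon>)) UNIV \<le> ennreal (1 + 1 / real (Suc k))"
        using ev[of k]
      proof eventually_elim
        case (elim \<epsilon>)
        have eq: "emeasure (energy_measure W a b \<epsilon> (u \<epsilon>)) UNIV = ennreal (1 / \<sigma>) * E_fun W \<epsilon> (u \<epsilon>) UNIV"
          unfolding E_fun_def by (rule emeas[OF elim]) simp
        have "ennreal (1 / \<sigma>) * ennreal \<sigma> \<le> ennreal (1 / \<sigma>) * E_fun W \<epsilon> (u \<epsilon>) UNIV"
          using concentratedD(5)[OF elim] unfolding \<sigma>_def by (rule mult_left_mono) simp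
        moreover have "ennreal (1 / \<sigma>) * E_fun W \<epsilon> (u \<epsilon>) UNIV \<le>
            ennreal (1 / \<sigma>) * ennreal (\<sigma> * (1 + 1 / real (Suc k)))"
          using concentratedD(6)[OF elim] unfolding \<sigma>_def by (rule mult_left_mono) simp
        moreover have "ennreal (1 / \<sigma>) * ennreal \<sigma> = 1"
          using \<sigma> by (simp flip: ennreal_mult)
        moreover have "ennreal (1 / \<sigma>) * ennreal (\<sigma> * (1 + 1 / real (Suc k))) = ennreal (1 + 1 / real (Suc k))"
          using \<sigma> by (subst ennreal_mult[symmetric]) auto
        ultimately show ?case unfolding eq by simp
      qed
      show "\<forall>\<^sub>F \<epsilon> in at_right 0. emeasure (energy_measure W a b \<epsilon> (u \<epsilon>)) (- cball 0 (1 / real (Suc k))) = 0"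
        using ev[of k]
      proof eventually_elim
        case (elim \<epsilon>)
        have "(\<integral>\<^sup>+x. ennreal (energy_density W \<epsilon> (u \<epsilon>) x) * indicator (- cball 0 (1 / real (Suc k))) x \<partial>lborel)
            = (\<integral>\<^sup>+x. 0 \<partial>(lborel :: (real ^ 'n) measure))"
          using concentratedD(4)[OF elim] by (intro nn_integral_cong) (auto split: split_indicator)
        then show ?case by (subst emeas[OF elim]) auto
      qed
    qed
  qed
qed

end
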